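(* Let $Q$ be a quiver whose underlying graph is the Dynkin diagram $A_n$ (any orientation), $n\ge 1$. Then the set of integers $l\ge 0$ such that $Q$ admits a maximal green sequence of length $l$ is exactly the integer interval $\{n, n+1, \dots, \tfrac{n(n+1)}{2}\}$.
   Context: A cluster quiver is a finite connected quiver without loops or oriented 2-cycles. For a cluster quiver $Q$, the framed quiver $\hat Q$ is obtained by adding, for each vertex $i$ of $Q$, a new frozen vertex $c(i)$ and an arrow $i\to c(i)$; the vertices of $Q$ are non-frozen. Mutation $\mu_k$ at a non-frozen vertex $k$ of a quiver $R$ (with frozen vertices): (1) for every pair of arrows $i\to k\to j$ add an arrow $i\to j$; (2) reverse every arrow incident to $k$; (3) remove a maximal collection of oriented 2-cycles and all arrows between frozen vertices. In a quiver $R$ obtained from $\hat Q$ by a finite sequence of mutations at non-frozen vertices, a non-frozen vertex $i$ is green if there is no arrow from a frozen vertex to $i$. A green sequence is a sequence $(i_1,\dots,i_l)$ of vertices of $Q$ such that $i_1$ is green in $\hat Q$ and $i_k$ is green in $\mu_{i_{k-1}}\cdots\mu_{i_1}\hat Q$ for $2\le k\le l$; its length is $l$. It is maximal if $\mu_{i_l}\cdots\mu_{i_1}\hat Q$ has no green vertex. *)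

theory Defs
  imports Main
begin

text \<open>A quiver (possibly with frozen vertices) on a vertex type 'v is given by its
arrow multiplicities: R i j = number of arrows from i to j.\<close>

type_synonym 'v quiver = "'v \<Rightarrow> 'v \<Rightarrow> nat"

definition is_An_quiver :: "nat \<Rightarrow> nat quiver \<Rightarrow> bool" where
  "is_An_quiver n Q \<longleftrightarrow>
     (\<forall>i j. \<not> (i < n \<and> j < n \<and> (j = i + 1 \<or> i = j + 1)) \<longrightarrow> Q i j = 0) \<and>
     (\<forall>i. i + 1 < n \<longrightarrow>
        (Q i (i+1) = 1 \<and> Q (i+1) i = 0) \<or> (Q i (i+1) = 0 \<and> Q (i+1) i = 1))"

text \<open>Framed quiver: non-frozen vertices Inl i, frozen vertices Inr i = c(i),
with an arrow Inl i -> Inr i for each vertex i < n of Q.\<close>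
definition frame :: "nat \<Rightarrow> nat quiver \<Rightarrow> (nat + nat) quiver" where
  "frame n Q = (\<lambda>x y. case (x, y) of
       (Inl i, Inl j) \<Rightarrow> Q i j
     | (Inl i, Inr j) \<Rightarrow> (if i = j \<and> i < n then 1 else 0)
     | _ \<Rightarrow> 0)"

definition frozen :: "nat + nat \<Rightarrow> bool" where
  "frozen x \<longleftrightarrow> (\<exists>j. x = Inr j)"

definition mutate :: "('v \<Rightarrow> bool) \<Rightarrow> 'v \<Rightarrow> 'v quiver \<Rightarrow> 'v quiver" where
  "mutate fr k R =
     (let R1 = (\<lambda>i j. if i \<noteq> k \<and> j \<noteq> k then R i j + R i k * R k j else R i j);
          R2 = (\<lambda>i j. if i = k \<or> j = k then R1 j i else R1 i j)
      in (\<lambda>i j. if fr i \<and> fr j then 0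
               else if i = j then R2 i j
               else R2 i j - min (R2 i j) (R2 j i)))"

definition green :: "(nat + nat) quiver \<Rightarrow> nat \<Rightarrow> bool" where
  "green R i \<longleftrightarrow> (\<forall>j. R (Inr j) (Inl i) = 0)"

definition mutate_seq :: "(nat + nat) quiver \<Rightarrow> nat list \<Rightarrow> (nat + nat) quiver" where
  "mutate_seq R s = foldl (\<lambda>R' i. mutate frozen (Inl i) R') R s"

fun green_from :: "nat \<Rightarrow> (nat + nat) quiver \<Rightarrow> nat list \<Rightarrow> bool" where
  "green_from n R [] = True"
| "green_from n R (i # s) =
     (i < n \<and> green R i \<and> green_from n (mutate frozen (Inl i) R) s)"

definition green_sequence :: "nat \<Rightarrow> nat quiver \<Rightarrow> nat list \<Rightarrow> bool" where
  "green_sequence n Q s \<longleftrightarrow> green_from n (frame n Q) s"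

definition maximal_green_sequence :: "nat \<Rightarrow> nat quiver \<Rightarrow> nat list \<Rightarrow> bool" where
  "maximal_green_sequence n Q s \<longleftrightarrow> green_sequence n Q s \<and>
     (\<forall>i < n. \<not> green (mutate_seq (frame n Q) s) i)"

end

theory Submission
  imports Defs
begin

text \<open>A c-vector of type $A_n$ is a signed interval, hence a directed edge on the vertices $0,\dots,n$, and it is
positive iff the edge ascends. The c-vectors of a seed reachable by green mutations form a directed tree, and the
exchange matrix is the value of a fixed skew form on pairs of edges. A green mutation reverses an ascending edge and
slides some adjacent edges along it.

Upper bound: along a green mutation every pair $a < b$ with a directed path from $b$ to $a$ keeps that property, and
the mutated edge yields a new such pair, so there are at most $n(n+1)/2$ mutations.
Lower bound: a vertex that is never mutated stays green.

No gaps: by induction on the number of pairs still missing, the lengths of completions of a seed form an interval,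
because two green mutations at the same seed extend to a square or a pentagon, whose two sides have lengths that differ
by at most one. Hence it is enough to exhibit lengths $n$ (mutate at sources) and $n(n+1)/2$ (mutate at green sinks, where
the tree remains a path and one inversion is added at each step).\<close>

subsection \<open>Edges and signed forms\<close>

text \<open>The exchange matrix and \<open>compat\<close> only see how edges meet, whereas a pair
  counted in the upper bound is the pair of ends of a path, possibly far from the mutated edge. The
  sidedness conditions close this gap: at a vertex of the relevant sign, everything behind an
  incoming edge (or beyond an outgoing one) lies on the side of the neighbour. With
  \<open>compat\<close> and the forest property they express Cambrian trees. Facts about heads of
  edges have twins about tails, obtained by the half-turn of the polygon combined with reversal of
  all edges. Chains run between sets of edges because the two sides of a pentagon agree only up to
  exchanging two labels. A mutation has two descriptions: adding vectors, which settles squares and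
  pentagons by linear arithmetic, and re-hanging edges at both ends of the mutated edge, which
  settles paths.\<close>

type_synonym edge = "int \<times> int"

text \<open>An antisymmetric potential: passing to its mixed difference makes \<open>omega\<close>
  additive when edges are concatenated.\<close>

definition vertex_sign :: "(int \<Rightarrow> bool) \<Rightarrow> int \<Rightarrow> int \<Rightarrow> int" where
  "vertex_sign s u v = (if u = v then 0 else if (if u < v then s v else \<not> s u) then 1 else -1)"

text \<open>The skew Euler form on intervals: the sign of an inner vertex $v$ is the direction of the arrow between the simple
roots meeting at $v$. With $0,\dots,n$ in convex position, vertices of positive sign below the line through $0$ and $n$ and
the others above, \<open>omega\<close> of two consecutive edges is the orientation of the triangle they span.\<close>

definition omega :: "(int \<Rightarrow> bool) \<Rightarrow> edge \<Rightarrow> edge \<Rightarrow> int" where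
  "omega s e f = vertex_sign s (fst e) (fst f) - vertex_sign s (fst e) (snd f) - vertex_sign s (snd e) (fst f) + vertex_sign s (snd e) (snd f)"

text \<open>The scalar product of the two roots, each being the unit vector of its tail minus that
  of its head. If exactly one vertex is shared, it is -1 for head to tail and 1 for two heads or two
  tails.\<close>

definition sym_form :: "edge \<Rightarrow> edge \<Rightarrow> int" where
  "sym_form e f = of_bool (fst e = fst f) - of_bool (fst e = snd f) - of_bool (snd e = fst f) + of_bool (snd e = snd f)"

definition ascending :: "edge \<Rightarrow> bool" where
  "ascending e \<longleftrightarrow> fst e < snd e"

text \<open>With $E$ the Euler form, half the sum of \<open>sym_form\<close> and the negative of \<open>omega\<close>, these are the conditions satisfied by
two members of a simple-minded collection: $E(e,f) = 0$ for $e$ positive and $f$ negative, and $E(e,f) \le 0$ for equal signs.\<close>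

definition compat :: "(int \<Rightarrow> bool) \<Rightarrow> edge \<Rightarrow> edge \<Rightarrow> bool" where
  "compat s e f \<longleftrightarrow> \<bar>omega s e f\<bar> = \<bar>sym_form e f\<bar> \<and> \<bar>sym_form e f\<bar> \<le> 1 \<and> (ascending e = ascending f \<longrightarrow> sym_form e f \<le> 0) \<and>
    (ascending e \<and> \<not> ascending f \<longrightarrow> omega s e f = sym_form e f) \<and> (\<not> ascending e \<and> ascending f \<longrightarrow> omega s f e = sym_form e f)"

lemma vertex_sign_antisym: "vertex_sign s v u = - vertex_sign s u v"
  by (auto simp: vertex_sign_def)

lemma omega_antisym: "omega s f e = - omega s e f"
  using vertex_sign_antisym[of s "fst e" "fst f"] vertex_sign_antisym[of s "fst e" "snd f"] 
    vertex_sign_antisym[of s "snd e" "fst f"] vertex_sign_antisym[of s "snd e" "snd f"]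
  by (simp add: omega_def)

lemma sym_form_sym: "sym_form f e = sym_form e f"
  by (simp add: sym_form_def eq_commute)

lemma compat_sym: "compat s f e = compat s e f"
  using omega_antisym[of s f e] sym_form_sym[of f e] by (auto simp: compat_def)

text \<open>The scalar product is 2 or -2 here. Distinctness of edges is later derived from
  compatibility through this fact.\<close>

lemma not_compat_refl: "a \<noteq> b \<Longrightarrow> \<not> compat s (a,b) (a,b)" "a \<noteq> b \<Longrightarrow> \<not> compat s (a,b) (b,a)"
  by (auto simp: compat_def sym_form_def)

lemma omega_split1: "omega s (x,q) f = omega s (x,p) f + omega s (p,q) f" 
  by (simp add: omega_def)

lemma omega_split2: "omega s f (x,q) = omega s f (x,p) + omega s f (p,q)" 
  by (simp add: omega_def)

lemma omega_rev1: "omega s (q,p) f = - omega s (p,q) f"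
  by (simp add: omega_def)

lemma sym_form_rev1: "sym_form (q,p) f = - sym_form (p,q) f"
  by (simp add: sym_form_def)

text \<open>The triangle from \<open>x\<close> through \<open>p\<close> to \<open>d\<close> turns
  counterclockwise in the convex polygon. For distinct vertices exactly one of the six orders
  applies, and it tests the sign of the middle vertex.\<close>

definition cyclic :: "(int \<Rightarrow> bool) \<Rightarrow> int \<Rightarrow> int \<Rightarrow> int \<Rightarrow> bool" where
  "cyclic s x p d \<longleftrightarrow> (x < p \<and> p < d \<longrightarrow> s p) \<and> (x < d \<and> d < p \<longrightarrow> \<not> s d) \<and> (p < x \<and> x < d \<longrightarrow> \<not> s x)
   \<and> (p < d \<and> d < x \<longrightarrow> s d) \<and> (d < x \<and> x < p \<longrightarrow> s x) \<and> (d < p \<and> p < x \<longrightarrow> \<not> s p)"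

lemma order_cases3:
  fixes x p d :: "'a::linorder"
  assumes "x \<noteq> p" "p \<noteq> d" "x \<noteq> d"
  obtains "x < p" "p < d" "x < d" | "x < d" "d < p" "x < p" | "p < x" "x < d" "p < d"
    | "p < d" "d < x" "p < x" | "d < x" "x < p" "d < p" | "d < p" "p < x" "d < x"
  using assms by (metis neq_iff order.strict_trans)

text \<open>The two terms containing the largest vertex cancel; the third carries the sign of the
  middle vertex.\<close>

lemma vertex_sign_cyclic:
  assumes "x \<noteq> p" "p \<noteq> d" "x \<noteq> d"
  shows "vertex_sign s x p + vertex_sign s p d + vertex_sign s d x = (if cyclic s x p d then 1 else -1)"
  by (rule order_cases3[OF assms]) (simp_all add: cyclic_def vertex_sign_def)

lemma omega_head_tail:
  assumes "x \<noteq> p" "p \<noteq> d" "x \<noteq> d"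
  shows "omega s (x,p) (p,d) = (if cyclic s x p d then 1 else -1)"
  using vertex_sign_cyclic[OF assms, of s] vertex_sign_antisym[of s x d]
  by (simp add: omega_def vertex_sign_def)

lemma omega_tail_tail:
  assumes "x \<noteq> p" "p \<noteq> d" "x \<noteq> d"
  shows "omega s (p,x) (p,d) = (if cyclic s x p d then -1 else 1)"
  using omega_head_tail[OF assms, of s] omega_rev1[of s p x "(p,d)"] by simp

lemma omega_tail_head:
  assumes "x \<noteq> p" "p \<noteq> d" "x \<noteq> d"
  shows "omega s (p,d) (x,p) = (if cyclic s x p d then -1 else 1)"
  using omega_head_tail[OF assms, of s] omega_antisym[of s "(p,d)"] by simp

lemma omega_head_head:
  assumes "x \<noteq> p" "p \<noteq> d" "x \<noteq> d"
  shows "omega s (x,p) (d,p) = (if cyclic s x p d then -1 else 1)"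
  using omega_tail_tail[OF assms, of s] by (simp add: omega_def)

lemma omega_disjoint:
  assumes "a \<noteq> c" "a \<noteq> d" "b \<noteq> c" "b \<noteq> d" "c \<noteq> d"
  shows "omega s (a,b) (c,d) = (if cyclic s a c d then 1 else -1) - (if cyclic s b c d then 1 else -1)"
proof -
  have "omega s (a,b) (c,d) = (vertex_sign s a c + vertex_sign s c d + vertex_sign s d a) - (vertex_sign s b c + vertex_sign s c d + vertex_sign s d b)"
    using vertex_sign_antisym[of s a d] vertex_sign_antisym[of s b d] by (simp add: omega_def)
  then show ?thesis using assms vertex_sign_cyclic[of a c d s] vertex_sign_cyclic[of b c d s] by presburger
qed

text \<open>Without a common vertex both forms must vanish, and \<open>omega\<close> compares the
  sides of the line through \<open>c\<close> and \<open>d\<close> on which \<open>a\<close> and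
  \<open>b\<close> lie. So compatibility says that the segments do not cross.\<close>

lemma compat_disjoint:
  assumes "a \<noteq> c" "a \<noteq> d" "b \<noteq> c" "b \<noteq> d" "c \<noteq> d"
  shows "compat s (a,b) (c,d) \<longleftrightarrow> (cyclic s a c d \<longleftrightarrow> cyclic s b c d)"
proof -
  have "sym_form (a,b) (c,d) = 0" using assms by (simp add: sym_form_def)
  then have "compat s (a,b) (c,d) \<longleftrightarrow> omega s (a,b) (c,d) = 0"
    using omega_antisym[of s "(a,b)" "(c,d)"] by (auto simp: compat_def)
  then show ?thesis by (simp add: omega_disjoint[OF assms])
qed

text \<open>There is no condition when \<open>p\<close> lies between \<open>x\<close> and
  \<open>d\<close>. Otherwise one edge ascends and the other descends, and the orientation of the
  triangle is forced.\<close>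

lemma compat_head_tail:
  assumes "x \<noteq> p" "p \<noteq> d" "x \<noteq> d"
  shows "compat s (x,p) (p,d) \<longleftrightarrow> (x < d \<and> d < p \<longrightarrow> s d) \<and> (d < x \<and> x < p \<longrightarrow> \<not> s x) \<and>
     (p < x \<and> x < d \<longrightarrow> \<not> s x) \<and> (p < d \<and> d < x \<longrightarrow> s d)"
  by (insert assms, rule order_cases3[OF assms]; simp add: compat_def omega_head_tail omega_tail_head sym_form_def ascending_def cyclic_def)

lemma compat_tail_head:
  assumes "x \<noteq> p" "p \<noteq> d" "x \<noteq> d"
  shows "compat s (p,d) (x,p) \<longleftrightarrow> (x < d \<and> d < p \<longrightarrow> s d) \<and> (d < x \<and> x < p \<longrightarrow> \<not> s x) \<and>
     (p < x \<and> x < d \<longrightarrow> \<not> s x) \<and> (p < d \<and> d < x \<longrightarrow> s d)"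
  using compat_head_tail[OF assms, of s] compat_sym by metis

text \<open>The scalar product is 1, which equal signs forbid. So two edges leave a vertex only if
  it is positive, one to each side; dually, two edges enter only a negative vertex.\<close>

lemma compat_tail_tail:
  assumes "x \<noteq> p" "p \<noteq> d" "x \<noteq> d"
  shows "compat s (p,x) (p,d) \<longleftrightarrow> s p \<and> (x < p \<longleftrightarrow> p < d)"
  by (insert assms, rule order_cases3[OF assms]; simp add: compat_def omega_tail_tail sym_form_def ascending_def cyclic_def)

lemma compat_head_head:
  assumes "x \<noteq> p" "p \<noteq> d" "x \<noteq> d"
  shows "compat s (x,p) (d,p) \<longleftrightarrow> \<not> s p \<and> (x < p \<longleftrightarrow> p < d)"
  by (insert assms, rule order_cases3[OF assms]; simp add: compat_def omega_head_head sym_form_def ascending_def cyclic_def)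

lemmas shapes = compat_head_tail compat_tail_head compat_tail_tail compat_head_head omega_head_tail omega_head_head omega_tail_tail omega_tail_head compat_disjoint omega_disjoint

lemma if_pm: "((if P then 1 else - 1::int) = 1) = P" "((if P then 1 else - 1::int) \<le> 0) = (\<not> P)"
  "((if P then - 1 else 1::int) \<le> 0) = P"
  by auto

section \<open>One edge slides while another stays: compatibility\<close>

lemma cyclic_less:
  assumes "p < q" "x \<noteq> p" "x \<noteq> q"
  shows "cyclic s x p q \<longleftrightarrow> (x < p \<longrightarrow> s p) \<and> (p < x \<and> x < q \<longrightarrow> \<not> s x) \<and> (q < x \<longrightarrow> s q)"
  by (rule order_cases3[of x p q]) (use assms in \<open>auto simp: cyclic_def\<close>)

lemma order_cases_less:
  fixes x p q :: "'a::linorder"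
  assumes "p < q" "x \<noteq> p" "x \<noteq> q"
  obtains "x < p" "x < q" | "p < x" "x < q" | "p < x" "q < x"
  using assms by (metis neq_iff order.strict_trans)

text \<open>The case of an edge \<open>(c,x)\<close> in the next lemma, reduced to orders and signs:
  the first two rows of \<open>h\<close> are the orientations of \<open>x p q\<close> and
  \<open>c p q\<close>, the last is compatibility of \<open>(c,x)\<close> with \<open>(x,p)\<close>.
  The conclusion is the same row with \<open>q\<close> for \<open>p\<close>.\<close>

lemma slide_head_order:
  fixes c x p q :: "'a::linorder" and s :: "'a \<Rightarrow> bool"
  assumes o: "p < q" "x \<noteq> p" "x \<noteq> q" "c \<noteq> p" "c \<noteq> q" 
   and h: "x < p \<longrightarrow> s p" "p < x \<and> x < q \<longrightarrow> \<not> s x" "q < x \<longrightarrow> s q"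
   "c < p \<longrightarrow> s p" "p < c \<and> c < q \<longrightarrow> \<not> s c" "q < c \<longrightarrow> s q"
   "c < p \<and> p < x \<longrightarrow> s p" "p < c \<and> c < x \<longrightarrow> \<not> s c" "x < c \<and> c < p \<longrightarrow> \<not> s c" "x < p \<and> p < c \<longrightarrow> s p"
 shows "(c < q \<and> q < x \<longrightarrow> s q) \<and> (q < c \<and> c < x \<longrightarrow> \<not> s c) \<and> (x < c \<and> c < q \<longrightarrow> \<not> s c) \<and> (x < q \<and> q < c \<longrightarrow> s q)"
  by (insert h, rule order_cases_less[OF o(1-3)]; rule order_cases_less[OF o(1,4,5)]; auto dest: order.strict_trans)

text \<open>If \<open>(c,d)\<close> avoids \<open>x\<close>, \<open>p\<close> and \<open>q\<close>,
  additivity of \<open>omega\<close> along \<open>x\<close>, \<open>p\<close>, \<open>q\<close>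
  suffices. The remaining cases list the vertices shared with the triangle and use its
  counterclockwise orientation.\<close>

lemma slide_head_compat:
  assumes "p < q" "x \<noteq> p" "x \<noteq> q" "c \<noteq> d"
  and sl: "omega s (x,p) (p,q) = 1" "compat s (x,p) (p,q)" "compat s (c,d) (p,q)" "compat s (x,p) (c,d)"
    "omega s (c,d) (p,q) \<le> 0"
  shows "compat s (x,q) (c,d)"
proof -
  have ne: "(c,d) \<noteq> (p,q)" "(c,d) \<noteq> (q,p)" "(c,d) \<noteq> (x,p)" "(c,d) \<noteq> (p,x)"
    using sl(3,4) assms(1,2) not_compat_refl[of p q s] not_compat_refl[of x p s] compat_sym by auto
  have cyq: "cyclic s x p q" using sl(1) assms by (simp add: omega_head_tail split: if_splits)
  consider "c = x" "d = q" | "c = q" "d = x" | "c = x" "d \<notin> {x,p,q}" | "d = x" "c \<notin> {x,p,q}" | "c = p" "d \<notin> {x,p,q}"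
    | "d = p" "c \<notin> {x,p,q}" | "c = q" "d \<notin> {x,p,q}" | "d = q" "c \<notin> {x,p,q}" | "c \<notin> {x,p,q}" "d \<notin> {x,p,q}"
    using ne assms(4) by auto
  then show ?thesis
  proof cases
    \<comment> \<open>The first two cases, where \<open>(c,d)\<close> would be the slid edge or its
      reverse, contradict the hypotheses.\<close>
    case 1
    then show ?thesis using assms by (simp add: shapes if_pm)
  next
    case 2
    then show ?thesis using assms by (simp add: shapes if_pm)
  next
    case 3
    have n: "d \<noteq> x" "d \<noteq> p" "d \<noteq> q" using 3 by auto
    have "s x" "p < x \<longleftrightarrow> x < d" using sl(4) n assms(2) unfolding 3(1) by (auto simp: compat_tail_tail)
    moreover have "p < x \<longleftrightarrow> q < x"
      using cyq \<open>s x\<close> assms(1-3) unfolding cyclic_less[OF assms(1-3)] by linarith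
    ultimately show ?thesis using n assms(1-3) unfolding 3(1) by (simp add: compat_tail_tail)
  next
    case 4
    have n: "c \<noteq> x" "c \<noteq> p" "c \<noteq> q" using 4 by auto
    have a: "cyclic s c p q" using sl(3) n assms cyq unfolding 4(1) by (simp add: compat_disjoint)
    have b: "(c < p \<and> p < x \<longrightarrow> s p) \<and> (p < c \<and> c < x \<longrightarrow> \<not> s c) \<and> (x < c \<and> c < p \<longrightarrow> \<not> s c) \<and> (x < p \<and> p < c \<longrightarrow> s p)"
      using sl(4) compat_tail_head[of c x p s] n assms(2) unfolding 4(1) by simp
    have "(c < q \<and> q < x \<longrightarrow> s q) \<and> (q < c \<and> c < x \<longrightarrow> \<not> s c) \<and> (x < c \<and> c < q \<longrightarrow> \<not> s c) \<and> (x < q \<and> q < c \<longrightarrow> s q)"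
      by (rule slide_head_order[OF assms(1-3) n(2,3)])
        (insert a[unfolded cyclic_less[OF assms(1) n(2,3)]] cyq[unfolded cyclic_less[OF assms(1-3)]] b, elim conjE, assumption)+
    then show ?thesis
      using compat_tail_head[of c x q s] n assms(3) unfolding 4(1) by simp
  next
    case 5
    have n: "d \<noteq> x" "d \<noteq> p" "d \<noteq> q" using 5 by auto
    have a: "s p" "d < p" using sl(3) n assms unfolding 5(1) by (auto simp: compat_tail_tail)
    have "(x < d \<longrightarrow> s d) \<and> (d < x \<and> x < p \<longrightarrow> \<not> s x)"
      using sl(4) compat_head_tail[of x p d s] a n assms(2) unfolding 5(1) by simp
    with a n assms(2) have "\<not> cyclic s x p d"
      by (cases rule: order_cases3[OF n(1)[symmetric] a(2)[THEN less_imp_neq] assms(2)]) (simp_all add: cyclic_def)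
    moreover have "\<not> cyclic s q p d" using a assms(1) by (simp add: cyclic_def)
    ultimately have "cyclic s x p d \<longleftrightarrow> cyclic s q p d" by simp
    then show ?thesis
      using n assms(1-3) unfolding 5(1) by (simp add: compat_disjoint)
  next
    case 6
    then show ?thesis using assms by (simp add: shapes if_pm) (simp add: cyclic_def)
  next
    case 7
    have n: "d \<noteq> x" "d \<noteq> p" "d \<noteq> q" using 7 by auto
    have pqd: "cyclic s p q d" "cyclic s x q d"
      using sl n assms(1-3) unfolding 7(1) by (auto simp: omega_tail_head compat_disjoint if_pm)
    have "(p < d \<and> d < q \<longrightarrow> s d) \<and> (d < p \<and> p < q \<longrightarrow> \<not> s p)"
      using sl(3) compat_tail_head[of p q d s] n assms(1) unfolding 7(1) by simp
    with pqd(1) n assms(1) have "q < d"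
      by (cases rule: order_cases_less[OF assms(1) n(2,3)]) (simp_all add: cyclic_def)
    then show ?thesis
      using pqd(2) n assms(3) unfolding 7(1) by (simp add: compat_head_tail cyclic_def)
  next
    case 8
    then show ?thesis using assms by (simp add: shapes if_pm)
  next
    case 9
    then have "sym_form (c,d) (p,q) = 0" "sym_form (x,p) (c,d) = 0" and n: "sym_form (x,q) (c,d) = 0" by (simp_all add: sym_form_def)
    then have "omega s (c,d) (p,q) = 0" "omega s (x,p) (c,d) = 0" using sl unfolding compat_def by simp_all
    then have "omega s (x,q) (c,d) = 0"
      using omega_split1[of s x q "(c,d)" p] omega_antisym[of s "(c,d)" "(p,q)"] by simp
    then show ?thesis using n omega_antisym[of s "(c,d)" "(x,q)"] by (simp add: compat_def)
  qed
qed

subsection \<open>Rotations of sided forests\<close>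

text \<open>The functions $h$ are the dual basis (g-vectors), as functions on the vertices up to constants; their existence
rules out cycles and survives mutation without an induction on paths.\<close>

definition forest :: "edge set \<Rightarrow> bool" where
  "forest F \<longleftrightarrow> (\<forall>e\<in>F. \<exists>h :: int \<Rightarrow> int. \<forall>g\<in>F. h (fst g) - h (snd g) = of_bool (e = g))"

text \<open>The global counterpart of the rule for two heads: not only \<open>x\<close> but
  everything that reaches \<open>x\<close> stays on its side of a negative vertex.\<close>

definition in_sided :: "(int \<Rightarrow> bool) \<Rightarrow> edge set \<Rightarrow> bool" where
  "in_sided s F \<longleftrightarrow> (\<forall>(x,v)\<in>F. \<not> s v \<longrightarrow> (\<forall>b. (b,x) \<in> F\<^sup>* \<longrightarrow> (b < v \<longleftrightarrow> x < v) \<and> b \<noteq> v))"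

definition out_sided :: "(int \<Rightarrow> bool) \<Rightarrow> edge set \<Rightarrow> bool" where
  "out_sided s F \<longleftrightarrow> (\<forall>(v,y)\<in>F. s v \<longrightarrow> (\<forall>a. (y,a) \<in> F\<^sup>* \<longrightarrow> (a < v \<longleftrightarrow> y < v) \<and> a \<noteq> v))"

lemma in_sidedD:
  assumes "in_sided s F" "(x,v) \<in> F" "\<not> s v" "(b,x) \<in> F\<^sup>*" shows "(b < v \<longleftrightarrow> x < v)" "b \<noteq> v"
  using assms unfolding in_sided_def by blast+

lemma out_sidedD:
  assumes "out_sided s F" "(v,y) \<in> F" "s v" "(y,a) \<in> F\<^sup>*" shows "(a < v \<longleftrightarrow> y < v)" "a \<noteq> v"
  using assms unfolding out_sided_def by blast+

section \<open>Directed paths in forests\<close>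

lemma forestE:
  assumes "forest F" "e \<in> F"
  obtains h :: "int \<Rightarrow> int" where "\<And>g. g \<in> F \<Longrightarrow> h (fst g) - h (snd g) = of_bool (e = g)"
    and "\<And>a b. (a,b) \<in> F\<^sup>* \<Longrightarrow> h a \<ge> h b"
proof -
  obtain h :: "int \<Rightarrow> int" where h: "\<And>g. g \<in> F \<Longrightarrow> h (fst g) - h (snd g) = of_bool (e = g)"
    using assms unfolding forest_def by blast
  have "h a \<ge> h b" if "(a,b) \<in> F\<^sup>*" for a b
    using that
  proof induction
    case (step y z)
    then show ?case using h[OF step(2)] by (simp add: of_bool_def split: if_splits)
  qed simp
  then show ?thesis using h that by blast
qed

lemma forest_acyclic:
  assumes "forest F" "(a,b) \<in> F" shows "(b,a) \<notin> F\<^sup>*"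
  by (rule forestE[OF assms]) (use assms(2) in force)

text \<open>The function dual to \<open>(w,q)\<close> is constant along \<open>(p,q)\<close> and
  larger by one at \<open>w\<close>, but it never increases along a path.\<close>

lemma forest_unique_path:
  assumes "forest F" "(p,q) \<in> F" "(w,q) \<in> F" "w \<noteq> p" shows "(p,w) \<notin> F\<^sup>*"
proof (rule forestE[OF assms(1,3)])
  fix h :: "int \<Rightarrow> int" assume h: "\<And>g. g \<in> F \<Longrightarrow> h (fst g) - h (snd g) = of_bool ((w,q) = g)"
    and mono: "\<And>a b. (a,b) \<in> F\<^sup>* \<Longrightarrow> h a \<ge> h b"
  show ?thesis using h[OF assms(2)] h[OF assms(3)] mono[of p w] assms(4) by auto
qed

lemma forest_no_triangle:
  assumes "forest F" "(a,b) \<in> F" "(b,c) \<in> F" "a \<noteq> b" "b \<noteq> c" shows "(a,c) \<notin> F"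
proof
  assume ac: "(a,c) \<in> F"
  obtain h :: "int \<Rightarrow> int" where h: "\<And>g. g \<in> F \<Longrightarrow> h (fst g) - h (snd g) = of_bool ((a,c) = g)"
    using assms(1) ac unfolding forest_def by blast
  show False using h[OF assms(2)] h[OF assms(3)] h[OF ac] assms(4,5) by simp
qed

text \<open>Cut the path before its first and after its last use of the edge.\<close>

lemma rtrancl_remove_edge:
  assumes "(b,a) \<in> F\<^sup>*"
  shows "(b,a) \<in> (F - {(p,q)})\<^sup>* \<or> (b,p) \<in> (F - {(p,q)})\<^sup>* \<and> (q,a) \<in> (F - {(p,q)})\<^sup>*"
  using assms
proof induction
  case (step y z)
  show ?case
  proof (cases "(y,z) = (p,q)")
    case True
    then show ?thesis using step.IH by auto
  next
    case False
    then have "(y,z) \<in> F - {(p,q)}" using step by auto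
    then show ?thesis using step.IH by (meson rtrancl.rtrancl_into_rtrancl)
  qed
qed simp

text \<open>What paths need to know of a mutation: \<open>X\<close> and \<open>Y\<close> are the far
  ends of the edges that slide at \<open>p\<close> and at \<open>q\<close>, and for every edge at
  \<open>p\<close> or \<open>q\<close> its side is tied to a sign. The assumptions are stable under
  duality, which exchanges \<open>p\<close> with \<open>q\<close> and \<open>X\<close> with
  \<open>Y\<close>.\<close>

locale rotation =
  fixes F :: "edge set" and s :: "int \<Rightarrow> bool" and p q :: int and X Y :: "int set"
  assumes forest: "forest F" and finite_X: "finite X" and finite_Y: "finite Y"
    and in_sided: "in_sided s F" and out_sided: "out_sided s F"
    and less: "p < q" and edge: "(p,q) \<in> F"
    and X: "\<And>x. x \<in> X \<Longrightarrow> (x,p) \<in> F" and Y: "\<And>y. y \<in> Y \<Longrightarrow> (q,y) \<in> F"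
    and in_p_fixed: "\<And>x. (x,p) \<in> F \<Longrightarrow> x \<notin> X \<Longrightarrow> x < p \<and> \<not> s p"
    and in_p_slid: "\<And>x. x \<in> X \<Longrightarrow> x < p \<Longrightarrow> s p"
    and out_p: "\<And>z. (p,z) \<in> F \<Longrightarrow> z \<noteq> q \<Longrightarrow> z < p \<and> s p"
    and in_q: "\<And>w. (w,q) \<in> F \<Longrightarrow> w \<noteq> p \<Longrightarrow> q < w \<and> \<not> s q"
    and out_q_fixed: "\<And>y. (q,y) \<in> F \<Longrightarrow> y \<notin> Y \<Longrightarrow> q < y \<and> s q"
    and out_q_slid: "\<And>y. y \<in> Y \<Longrightarrow> q < y \<Longrightarrow> \<not> s q"
begin

definition F' :: "edge set" where
  "F' = (F - {(p,q)} - X \<times> {p} - {q} \<times> Y) \<union> {(q,p)} \<union> X \<times> {q} \<union> {p} \<times> Y"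

lemma F'_cases:
  assumes "(a,b) \<in> F'"
  obtains "a = q" "b = p" | "a \<in> X" "b = q" | "a = p" "b \<in> Y"
    | "(a,b) \<in> F" "(a,b) \<noteq> (p,q)" "\<not> (a \<in> X \<and> b = p)" "\<not> (a = q \<and> b \<in> Y)"
  using assms unfolding F'_def by auto

text \<open>Apart from the reversed edge, a new edge is an old one or a shortcut for two consecutive
  old ones.\<close>

lemma F'_step: "(a,b) \<in> F' \<Longrightarrow> (a,b) \<noteq> (q,p) \<Longrightarrow> (a,b) \<in> F\<^sup>*"
  by (erule F'_cases) (auto dest: X Y intro: edge r_into_rtrancl converse_rtrancl_into_rtrancl)

lemma F'_path:
  assumes "(b,a) \<in> F'\<^sup>*"
  shows "(b,a) \<in> F\<^sup>* \<or> (b,q) \<in> F\<^sup>* \<and> (p,a) \<in> F\<^sup>*"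
  using assms
proof induction
  case (step y z)
  show ?case
  proof (cases "(y,z) = (q,p)")
    case True
    then show ?thesis using step.IH by auto
  next
    case False
    then show ?thesis using F'_step[OF step.hyps(2)] step.IH by (meson rtrancl_trans)
  qed
qed simp

lemma no_back: "(p,x) \<in> F\<^sup>* \<Longrightarrow> (x,p) \<notin> F"
  using forest_acyclic[OF forest] by blast

lemma no_parallel: "(p,w) \<in> F\<^sup>* \<Longrightarrow> (w,q) \<in> F \<Longrightarrow> w = p"
  using forest_unique_path[OF forest edge] by blast

text \<open>An edge into \<open>q\<close> other than \<open>(p,q)\<close> comes from the right and
  forces \<open>q\<close> to be negative, so sidedness puts everything behind it to the
  right.\<close>

lemma to_q:
  assumes "(b,q) \<in> F\<^sup>*" obtains "b = q" | "(b,p) \<in> F\<^sup>*" | "q < b"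
  using assms
proof (cases rule: rtranclE)
  case (step w)
  show ?thesis
  proof (cases "w = p")
    case False
    then have "q < w" "\<not> s q" using in_q step(2) by auto
    then have "q < b" using in_sidedD[OF in_sided step(2) _ step(1)] by linarith
    then show ?thesis using that by blast
  qed (use step that in blast)
qed (use that in blast)

text \<open>A path that was not there before uses the reversed edge, so its start reaches
  \<open>q\<close> in the old forest and \<open>to_q\<close> locates it.\<close>

lemma in_sided': "in_sided s F'"
  unfolding in_sided_def
proof (clarify)
  fix x v b assume xv: "(x,v) \<in> F'" and v: "\<not> s v" and b: "(b,x) \<in> F'\<^sup>*"
  from xv show "(b < v \<longleftrightarrow> x < v) \<and> b \<noteq> v"
  proof (cases rule: F'_cases)
    case 1
    \<comment> \<open>With \<open>p\<close> negative, an edge that slid from \<open>p\<close> to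
      \<open>q\<close> came from the right of \<open>p\<close>; any other edge into \<open>q\<close>
      comes from the right of \<open>q\<close>.\<close>
    have "p < b"
      using b unfolding 1
    proof (cases rule: rtranclE)
      case base
      then show ?thesis using less by simp
    next
      case (step w)
      from step(2) show ?thesis
      proof (cases rule: F'_cases)
        case 2
        then have w: "(w,p) \<in> F" using X by blast
        have sp: "\<not> s p" using v 1 by simp
        have "w \<noteq> p" using w no_back by blast
        then have "p < w" using in_p_slid[OF 2(1)] sp by force
        moreover have "(b,w) \<in> F\<^sup>*" using F'_path[OF step(1)] no_back w by blast
        ultimately show ?thesis using in_sidedD[OF in_sided w sp, of b] by force
      next
        case 4
        then have w: "w \<noteq> p" by auto
        then have "(b,w) \<in> F\<^sup>*" using F'_path[OF step(1)] no_parallel 4(1) by blast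
        then show ?thesis using in_sidedD[OF in_sided 4(1)] in_q[OF 4(1) w] less by force
      qed (use less Y forest_acyclic[OF forest, of q q] in auto)
    qed
    then show ?thesis using 1 less by auto
  next
    case 2
    then have "(b,x) \<in> F\<^sup>*" using F'_path[OF b] no_back X by blast
    moreover have "(x,p) \<in> F" using X 2 by auto
    ultimately have "(b,p) \<in> F\<^sup>*" "(x,p) \<in> F\<^sup>*" by auto
    then show ?thesis using in_sidedD[OF in_sided edge] v 2 less by blast
  next
    case 3
    then have "(b,q) \<in> F\<^sup>*" using F'_path[OF b] edge by auto
    then show ?thesis using in_sidedD[OF in_sided Y[OF 3(2)] v] 3 edge by blast
  next
    case 4
    from F'_path[OF b] show ?thesis
    proof
      assume "(b,x) \<in> F\<^sup>*" then show ?thesis using in_sidedD[OF in_sided 4(1) v] by blast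
    next
      assume bp: "(b,q) \<in> F\<^sup>* \<and> (p,x) \<in> F\<^sup>*"
      show ?thesis
      proof (cases "(b,x) \<in> F\<^sup>*")
        case True
        then show ?thesis using in_sidedD[OF in_sided 4(1) v] by blast
      next
        case False
        then have bq: "q \<le> b" using to_q bp by (metis order.order_iff_strict rtrancl_trans)
        \<comment> \<open>As \<open>p\<close> reaches \<open>x\<close>, it lies on the side of
          \<open>x\<close> with respect to \<open>v\<close>. So \<open>v < p\<close> puts
          \<open>x\<close> to the right of \<open>v\<close>, where \<open>b\<close> is as
          well.\<close>
        have "v < p"
        proof (cases "x = p")
          case True
          then show ?thesis using out_p 4 by blast
        next
          case False
          then obtain z where z: "(p,z) \<in> F" "(z,x) \<in> F\<^sup>*" using bp by (metis converse_rtranclE)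
          then have "z \<noteq> q" using \<open>(b,x) \<notin> F\<^sup>*\<close> bp by (meson rtrancl_trans)
          moreover have "(z,v) \<in> F\<^sup>*" using z 4(1) by auto
          ultimately show ?thesis using out_p[OF z(1)] out_sidedD[OF out_sided z(1)] by blast
        qed
        then show ?thesis using bq less in_sidedD[OF in_sided 4(1) v, of p] in_sidedD[OF in_sided 4(1) v, of x] bp by force
      qed
    qed
  qed
qed

text \<open>A slid edge survives as a path of two edges through the reversed edge.\<close>

lemma old_step:
  assumes "(a,b) \<in> F" "(a,b) \<noteq> (p,q)" shows "(a,b) \<in> F'\<^sup>*"
proof -
  have qp: "(q,p) \<in> F'" by (simp add: F'_def)
  consider "a \<in> X" "b = p" | "a = q" "b \<in> Y" | "(a,b) \<in> F'" using assms by (auto simp: F'_def)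
  then show ?thesis
  proof cases
    case 1
    then have "(a,q) \<in> F'" by (simp add: F'_def)
    then show ?thesis using qp 1 by auto
  next
    case 2
    then have "(p,b) \<in> F'" by (simp add: F'_def)
    then show ?thesis using qp 2 by auto
  qed auto
qed

lemma old_path: "(a,b) \<in> (F - {(p,q)})\<^sup>* \<Longrightarrow> (a,b) \<in> F'\<^sup>*"
  by (induction rule: rtrancl_induct) (use old_step in \<open>auto intro: rtrancl_trans\<close>)

text \<open>Only a path through \<open>(p,q)\<close> can break. If \<open>b\<close> still reaches
  \<open>q\<close>, or \<open>p\<close> still reaches \<open>a\<close>, the path is repaired.
  Otherwise the path entered \<open>p\<close> and left \<open>q\<close> along edges that did not
  slide, and sidedness gives \<open>b \<le> p < q \<le> a\<close>, contrary to
  \<open>a < b\<close>.\<close>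

lemma inversions_preserved:
  assumes "(b,a) \<in> F\<^sup>*" "a < b" shows "(b,a) \<in> F'\<^sup>*"
proof -
  let ?G = "F - {(p,q)}"
  have G: "(u,v) \<in> F\<^sup>*" if "(u,v) \<in> ?G\<^sup>*" for u v using that by (meson Diff_subset in_mono rtrancl_mono)
  from rtrancl_remove_edge[OF assms(1), of p q] show ?thesis
  proof
    assume "(b,a) \<in> ?G\<^sup>*" then show ?thesis by (rule old_path)
  next
    assume *: "(b,p) \<in> ?G\<^sup>* \<and> (q,a) \<in> ?G\<^sup>*"
    have le: "b \<le> p" if "(b,q) \<notin> F'\<^sup>*"
    proof (cases "b = p")
      case False
      then obtain x where x: "(b,x) \<in> ?G\<^sup>*" "(x,p) \<in> ?G" using * by (metis rtranclE)
      have "x \<notin> X"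
      proof
        assume "x \<in> X"
        then have "(x,q) \<in> F'" by (simp add: F'_def)
        then show False using old_path[OF x(1)] that by (meson rtrancl.rtrancl_into_rtrancl)
      qed
      then show ?thesis using in_p_fixed[of x] x in_sidedD[OF in_sided _ _ G[OF x(1)], of p] by force
    qed simp
    have ge: "q \<le> a" if "(p,a) \<notin> F'\<^sup>*"
    proof (cases "a = q")
      case False
      then obtain y where y: "(q,y) \<in> ?G" "(y,a) \<in> ?G\<^sup>*" using * by (metis converse_rtranclE)
      have "y \<notin> Y"
      proof
        assume "y \<in> Y"
        then have "(p,y) \<in> F'" by (simp add: F'_def)
        then show False using old_path[OF y(2)] that by (meson converse_rtrancl_into_rtrancl)
      qed
      then show ?thesis using out_q_fixed[of y] y out_sidedD[OF out_sided _ _ G[OF y(2)], of q] by force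
    qed simp
    show ?thesis
      using le ge old_path * assms(2) less by (meson dual_order.strict_trans1 dual_order.strict_trans2 order.asym rtrancl_trans)
  qed
qed

lemma new_inversion: "(q,p) \<in> F'\<^sup>*" "(q,p) \<notin> F\<^sup>*"
  using forest_acyclic[OF forest edge] by (auto simp: F'_def)

text \<open>The dual basis is mutated along. The function dual to an old edge other than
  \<open>(p,q)\<close> agrees at \<open>p\<close> and \<open>q\<close>, hence is dual to the image
  of that edge; only the reversed edge needs a new function.\<close>

lemma forest': "forest F'"
  unfolding forest_def
proof
  fix e assume "e \<in> F'"
  have nqp: "(q,p) \<notin> F" using new_inversion(2) by auto
  have npp: "(p,p) \<notin> F" "(q,q) \<notin> F" using forest_acyclic[OF forest, of p p] forest_acyclic[OF forest, of q q] by auto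
  have X_ne: "x \<noteq> p" "x \<noteq> q" if "x \<in> X" for x using X[OF that] nqp npp by auto
  have Y_ne: "y \<noteq> q" "y \<noteq> p" if "y \<in> Y" for y using Y[OF that] nqp npp by auto
  have X_q: "(x,q) \<notin> F" if "x \<in> X" for x
    using forest_no_triangle[OF forest X[OF that] edge] X_ne[OF that] less by blast
  have Y_p: "(p,y) \<notin> F" if "y \<in> Y" for y
    using forest_no_triangle[OF forest edge Y[OF that]] Y_ne[OF that] less by blast
  have pull: "\<exists>h::int\<Rightarrow>int. \<forall>g\<in>F'. h (fst g) - h (snd g) = of_bool (e = g)"
    if f: "f \<in> F" "f \<noteq> (p,q)" "e \<noteq> (q,p)"
      and eqX: "\<And>x. x \<in> X \<Longrightarrow> f = (x,p) \<longleftrightarrow> e = (x,q)" 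
      and eqY: "\<And>y. y \<in> Y \<Longrightarrow> f = (q,y) \<longleftrightarrow> e = (p,y)"
      and eq: "\<And>g. g \<in> F \<Longrightarrow> g \<in> F' \<Longrightarrow> f = g \<longleftrightarrow> e = g" for f
  proof -
    obtain h :: "int \<Rightarrow> int" where h: "\<And>g. g \<in> F \<Longrightarrow> h (fst g) - h (snd g) = of_bool (f = g)"
      using forest f(1) unfolding forest_def by blast
    have hpq: "h p = h q" using h[OF edge] f(2) by simp
    have "h (fst g) - h (snd g) = of_bool (e = g)" if g: "g \<in> F'" for g
    proof -
      obtain a b where ab: "g = (a,b)" by (cases g)
      from g[unfolded ab] show ?thesis
      proof (cases rule: F'_cases)
        case 1
        then show ?thesis using hpq f(3) ab by simp
      next
        case 2
        then show ?thesis using h[OF X[OF 2(1)]] eqX[OF 2(1)] hpq ab by simp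
      next
        case 3
        then show ?thesis using h[OF Y[OF 3(2)]] eqY[OF 3(2)] hpq ab by simp
      next
        case 4
        then show ?thesis using h[OF 4(1)] eq[OF 4(1)] g ab by simp
      qed
    qed
    then show ?thesis by blast
  qed
  obtain a b where ab: "e = (a,b)" by (cases e)
  from \<open>e \<in> F'\<close>[unfolded ab] show "\<exists>h::int\<Rightarrow>int. \<forall>g\<in>F'. h (fst g) - h (snd g) = of_bool (e = g)"
  proof (cases rule: F'_cases)
    case 1
    have "\<forall>f\<in>F. \<exists>h::int\<Rightarrow>int. \<forall>g\<in>F. h (fst g) - h (snd g) = of_bool (f = g)"
      using forest unfolding forest_def .
    then obtain H :: "edge \<Rightarrow> int \<Rightarrow> int" where
      H: "\<And>f g. f \<in> F \<Longrightarrow> g \<in> F \<Longrightarrow> H f (fst g) - H f (snd g) = of_bool (f = g)"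
      by metis
    define S where "S = X \<times> {p} \<union> {q} \<times> Y"
    have S: "finite S" "S \<subseteq> F" "(p,q) \<notin> S" using finite_X finite_Y X Y less by (auto simp: S_def)
    \<comment> \<open>The exchange rule for g-vectors: minus the old vector plus those of all edges
      with an arrow to \<open>(p,q)\<close>. Each slid edge contributes 1, which the drop of -1
      along \<open>(p,q)\<close> cancels on its image.\<close>
    define h where "h u = - H (p,q) u + (\<Sum>f\<in>S. H f u)" for u
    have h: "h (fst g) - h (snd g) = of_bool (g \<in> S) - of_bool (g = (p,q))" if g: "g \<in> F" for g
    proof -
      have "(\<Sum>f\<in>S. H f (fst g)) - (\<Sum>f\<in>S. H f (snd g)) = (\<Sum>f\<in>S. of_bool (f = g))"
        unfolding sum_subtractf[symmetric] by (intro sum.cong refl H[OF subsetD[OF S(2)] g])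
      also have "\<dots> = of_bool (g \<in> S)" using S(1) by (simp add: of_bool_def)
      finally show ?thesis using H[OF edge g] by (auto simp: h_def)
    qed
    have hpq: "h q - h p = 1" using h[OF edge] S(3) by simp
    have "h (fst g) - h (snd g) = of_bool (e = g)" if g: "g \<in> F'" for g
    proof -
      obtain c d where cd: "g = (c,d)" by (cases g)
      from g[unfolded cd] show ?thesis
      proof (cases rule: F'_cases)
        case 1
        then show ?thesis using hpq \<open>a = q\<close> \<open>b = p\<close> ab cd by simp
      next
        case 2
        have "(c,p) \<in> S" using 2 by (simp add: S_def)
        then show ?thesis using h[OF X[OF 2(1)]] 2 hpq less \<open>a = q\<close> \<open>b = p\<close> ab cd by auto
      next
        case 3
        have "(q,d) \<in> S" using 3 by (simp add: S_def)
        then show ?thesis using h[OF Y[OF 3(2)]] 3 hpq less \<open>a = q\<close> \<open>b = p\<close> ab cd by auto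
      next
        case 4
        then have "g \<notin> S" "g \<noteq> e" using nqp \<open>a = q\<close> \<open>b = p\<close> ab cd by (auto simp: S_def)
        then show ?thesis using h[OF 4(1)] 4(2) cd by auto
      qed
    qed
    then show ?thesis by blast
  next
    case 2
    show ?thesis
    proof (rule pull)
      show "(a,p) \<in> F" by (rule X[OF 2(1)])
      show "(a,p) \<noteq> (p,q)" "e \<noteq> (q,p)" using less 2 ab X_ne[OF 2(1)] by auto
      show "(a,p) = (x,p) \<longleftrightarrow> e = (x,q)" if "x \<in> X" for x using 2 ab by auto
      show "(a,p) = (q,y) \<longleftrightarrow> e = (p,y)" if "y \<in> Y" for y using 2 ab X_ne[OF 2(1)] by auto
      show "(a,p) = g \<longleftrightarrow> e = g" if "g \<in> F" "g \<in> F'" for g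
        using X_q[OF 2(1)] that 2 ab X_ne[OF 2(1)] less by (auto simp: F'_def)
    qed
  next
    case 3
    show ?thesis
    proof (rule pull)
      show "(q,b) \<in> F" by (rule Y[OF 3(2)])
      show "(q,b) \<noteq> (p,q)" "e \<noteq> (q,p)" using less 3 ab Y_ne[OF 3(2)] by auto
      show "(q,b) = (x,p) \<longleftrightarrow> e = (x,q)" if "x \<in> X" for x using 3 ab Y_ne[OF 3(2)] by auto
      show "(q,b) = (q,y) \<longleftrightarrow> e = (p,y)" if "y \<in> Y" for y using 3 ab by auto
      show "(q,b) = g \<longleftrightarrow> e = g" if "g \<in> F" "g \<in> F'" for g
        using Y_p[OF 3(2)] that 3 ab Y_ne[OF 3(2)] less by (auto simp: F'_def)
    qed
  next
    case 4
    show ?thesis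
    proof (rule pull)
      show "(a,b) \<in> F" "(a,b) \<noteq> (p,q)" by (rule 4)+
      show "e \<noteq> (q,p)" using 4(1) nqp ab by auto
      show "(a,b) = (x,p) \<longleftrightarrow> e = (x,q)" if "x \<in> X" for x using 4 ab X_q[OF that] that by auto
      show "(a,b) = (q,y) \<longleftrightarrow> e = (p,y)" if "y \<in> Y" for y using 4 ab Y_p[OF that] that by auto
    qed (use ab in simp)
  qed
qed

end

subsection \<open>Duality and the shape of slides\<close>

text \<open>Negation is a half-turn of the polygon, so vertex signs are flipped. Exchanging the ends
  keeps ascending edges ascending and turns statements about heads into statements about
  tails.\<close>

definition dual_edge :: "edge \<Rightarrow> edge" where "dual_edge e = (- snd e, - fst e)"

definition dual_sign :: "(int \<Rightarrow> bool) \<Rightarrow> int \<Rightarrow> bool" where "dual_sign s v \<longleftrightarrow> \<not> s (- v)"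

lemma dual_edge_dual_edge [simp]: "dual_edge (dual_edge e) = e"
  by (simp add: dual_edge_def)

lemma dual_edge_in_iff: "e \<in> dual_edge ` F \<longleftrightarrow> dual_edge e \<in> F"
  by (metis dual_edge_dual_edge image_iff)

lemma dual_edge_in_iff': "(a,b) \<in> dual_edge ` F \<longleftrightarrow> (-b,-a) \<in> F"
  by (simp add: dual_edge_in_iff dual_edge_def[of "(a,b)"])

text \<open>Replacing the sign of the larger by the sign of the smaller vertex changes the potential by a coboundary only.\<close>

lemma vertex_sign_dual: "vertex_sign (dual_sign s) (-u) (-v) = vertex_sign s u v - (if s v then 1 else -1) + (if s u then 1 else -1)"
  by (cases u v rule: linorder_cases) (auto simp: vertex_sign_def dual_sign_def)

lemma omega_dual: "omega (dual_sign s) (dual_edge e) (dual_edge f) = omega s e f"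
  by (simp add: omega_def dual_edge_def vertex_sign_dual)

lemma sym_form_dual: "sym_form (dual_edge e) (dual_edge f) = sym_form e f"
  by (simp add: sym_form_def dual_edge_def)

lemma ascending_dual: "ascending (dual_edge e) = ascending e"
  by (simp add: ascending_def dual_edge_def)

lemma compat_dual: "compat (dual_sign s) (dual_edge e) (dual_edge f) = compat s e f"
  by (simp add: compat_def omega_dual sym_form_dual ascending_dual)

lemma dual_edge_rtrancl: "(a,b) \<in> (dual_edge ` F)\<^sup>* \<longleftrightarrow> (-b,-a) \<in> F\<^sup>*"
proof -
  have *: "(-b,-a) \<in> G\<^sup>*" if "(a,b) \<in> (dual_edge ` G)\<^sup>*" for a b G
    using that
  proof induction
    case (step y z)
    then show ?case using dual_edge_in_iff'[of y z G] by (metis converse_rtrancl_into_rtrancl)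
  qed simp
  show ?thesis using *[of a b F] *[of "-b" "-a" "dual_edge ` F"] by (auto simp: image_image)
qed

lemma dual_sign_dual_sign [simp]: "dual_sign (dual_sign s) = s"
  by (simp add: dual_sign_def fun_eq_iff)

lemma dual_edge_image_dual_edge [simp]: "dual_edge ` dual_edge ` F = F"
  by (simp add: image_image)

lemma in_sidedI:
  assumes "\<And>x v b. (x,v) \<in> F \<Longrightarrow> \<not> s v \<Longrightarrow> (b,x) \<in> F\<^sup>* \<Longrightarrow> (b < v \<longleftrightarrow> x < v) \<and> b \<noteq> v"
  shows "in_sided s F"
  using assms unfolding in_sided_def by auto

lemma out_sidedI:
  assumes "\<And>v y a. (v,y) \<in> F \<Longrightarrow> s v \<Longrightarrow> (y,a) \<in> F\<^sup>* \<Longrightarrow> (a < v \<longleftrightarrow> y < v) \<and> a \<noteq> v"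
  shows "out_sided s F"
  using assms unfolding out_sided_def by auto

lemma uminus_mem: "x \<in> uminus ` A \<longleftrightarrow> - x \<in> A" for x :: int
  by force

lemma in_sided_dual: assumes "out_sided s F" shows "in_sided (dual_sign s) (dual_edge ` F)"
proof (rule in_sidedI)
  fix x v b assume "(x,v) \<in> dual_edge ` F" "\<not> dual_sign s v" "(b,x) \<in> (dual_edge ` F)\<^sup>*"
  then have e: "(-v,-x) \<in> F" "s (-v)" and b: "(-x,-b) \<in> F\<^sup>*" by (simp_all add: dual_edge_in_iff' dual_sign_def dual_edge_rtrancl)
  show "(b < v \<longleftrightarrow> x < v) \<and> b \<noteq> v"
    using out_sidedD[OF assms e b] out_sidedD[OF assms e, of "-x"] by force
qed

lemma out_sided_dual: assumes "in_sided s F" shows "out_sided (dual_sign s) (dual_edge ` F)"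
proof (rule out_sidedI)
  fix v y a assume "(v,y) \<in> dual_edge ` F" "dual_sign s v" "(y,a) \<in> (dual_edge ` F)\<^sup>*"
  then have e: "(-y,-v) \<in> F" "\<not> s (-v)" and a: "(-a,-y) \<in> F\<^sup>*" by (simp_all add: dual_edge_in_iff' dual_sign_def dual_edge_rtrancl)
  show "(a < v \<longleftrightarrow> y < v) \<and> a \<noteq> v"
    using in_sidedD[OF assms e a] in_sidedD[OF assms e, of "-y"] by force
qed

lemma forest_dual: assumes "forest F" shows "forest (dual_edge ` F)"
  unfolding forest_def
proof
  fix e assume "e \<in> dual_edge ` F"
  then obtain h :: "int \<Rightarrow> int" where h: "\<And>g. g \<in> F \<Longrightarrow> h (fst g) - h (snd g) = of_bool (dual_edge e = g)"
    using assms unfolding forest_def dual_edge_in_iff by blast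
  have "- h (- fst g) - - h (- snd g) = of_bool (e = g)" if "g \<in> dual_edge ` F" for g
    using h[of "dual_edge g"] that by (auto simp: dual_edge_in_iff dual_edge_def prod_eq_iff)
  then show "\<exists>h :: int \<Rightarrow> int. \<forall>g\<in>dual_edge ` F. h (fst g) - h (snd g) = of_bool (e = g)"
    by (intro exI[of _ "\<lambda>u. - h (- u)"]) simp
qed

context rotation
begin

lemma dual: "rotation (dual_edge ` F) (dual_sign s) (-q) (-p) (uminus ` Y) (uminus ` X)"
proof
  show "forest (dual_edge ` F)" by (rule forest_dual[OF forest])
  show "finite (uminus ` Y)" "finite (uminus ` X)" using finite_X finite_Y by auto
  show "in_sided (dual_sign s) (dual_edge ` F)" by (rule in_sided_dual[OF out_sided])
  show "out_sided (dual_sign s) (dual_edge ` F)" by (rule out_sided_dual[OF in_sided])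
  show "-q < -p" "(-q,-p) \<in> dual_edge ` F" using less edge by (auto simp: dual_edge_in_iff')
  show "(x,-q) \<in> dual_edge ` F" if "x \<in> uminus ` Y" for x using that Y by (auto simp: dual_edge_in_iff')
  show "(-p,y) \<in> dual_edge ` F" if "y \<in> uminus ` X" for y using that X by (auto simp: dual_edge_in_iff')
  show "x < -q \<and> \<not> dual_sign s (-q)" if "(x,-q) \<in> dual_edge ` F" "x \<notin> uminus ` Y" for x
    using out_q_fixed[of "-x"] that[unfolded dual_edge_in_iff' uminus_mem] by (simp add: dual_sign_def)
  show "dual_sign s (-q)" if "x \<in> uminus ` Y" "x < -q" for x
    using out_q_slid[of "-x"] that[unfolded uminus_mem] by (simp add: dual_sign_def)
  show "z < -q \<and> dual_sign s (-q)" if "(-q,z) \<in> dual_edge ` F" "z \<noteq> -p" for z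
    using in_q[of "-z"] that[unfolded dual_edge_in_iff'] by (simp add: dual_sign_def)
  show "-p < w \<and> \<not> dual_sign s (-p)" if "(w,-p) \<in> dual_edge ` F" "w \<noteq> -q" for w
    using out_p[of "-w"] that[unfolded dual_edge_in_iff'] by (simp add: dual_sign_def)
  show "-p < y \<and> dual_sign s (-p)" if "(-p,y) \<in> dual_edge ` F" "y \<notin> uminus ` X" for y
    using in_p_fixed[of "-y"] that[unfolded dual_edge_in_iff' uminus_mem] by (simp add: dual_sign_def)
  show "\<not> dual_sign s (-p)" if "y \<in> uminus ` X" "-p < y" for y
    using in_p_slid[of "-y"] that[unfolded uminus_mem] by (simp add: dual_sign_def)
qed

lemma F'_iff: "(a,b) \<in> F' \<longleftrightarrow> (a = q \<and> b = p) \<or> (a \<in> X \<and> b = q) \<or> (a = p \<and> b \<in> Y) \<or>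
    ((a,b) \<in> F \<and> (a,b) \<noteq> (p,q) \<and> \<not> (a \<in> X \<and> b = p) \<and> \<not> (a = q \<and> b \<in> Y))"
  unfolding F'_def by auto

lemma dual_F': "rotation.F' (dual_edge ` F) (-q) (-p) (uminus ` Y) (uminus ` X) = dual_edge ` F'"
proof -
  have neg: "x = - y \<longleftrightarrow> - x = y" for x y :: int by auto
  have "(a,b) \<in> rotation.F' (dual_edge ` F) (-q) (-p) (uminus ` Y) (uminus ` X) \<longleftrightarrow> (a,b) \<in> dual_edge ` F'" for a b
    unfolding rotation.F'_iff[OF dual] dual_edge_in_iff' F'_iff uminus_mem prod.inject neg by blast
  then show ?thesis by auto
qed

lemma out_sided': "out_sided s F'"
  using out_sided_dual[OF rotation.in_sided'[OF dual]] by (simp add: dual_F')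

end

lemma slide_tail_compat:
  assumes "p < q" "y \<noteq> p" "y \<noteq> q" "c \<noteq> d" "omega s (q,y) (p,q) = 1" "compat s (q,y) (p,q)" "compat s (c,d) (p,q)"
    "compat s (q,y) (c,d)" "omega s (c,d) (p,q) \<le> 0"
  shows "compat s (p,y) (c,d)"
proof -
  have "compat (dual_sign s) (dual_edge (p,y)) (dual_edge (c,d))"
    using slide_head_compat[of "-q" "-p" "-y" "-d" "-c" "dual_sign s"] assms omega_dual[of s "(q,y)" "(p,q)"]
     compat_dual[of s "(q,y)" "(p,q)"] compat_dual[of s "(c,d)" "(p,q)"] compat_dual[of s "(q,y)" "(c,d)"]
     omega_dual[of s "(c,d)" "(p,q)"]
    by (simp add: dual_edge_def)
  then show ?thesis by (simp add: compat_dual)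
qed

text \<open>Mutation of c-vectors at a green \<open>f\<close>: add \<open>f\<close> to every
  \<open>e\<close> with an arrow to \<open>f\<close>. Under compatibility such edges meet head to
  tail, so the sum is again an edge; in the last branch \<open>f\<close> comes first.\<close>

definition slide :: "(int \<Rightarrow> bool) \<Rightarrow> edge \<Rightarrow> edge \<Rightarrow> edge" where
  "slide s f e = (if omega s e f \<le> 0 then e else if snd e = fst f then (fst e, snd f) else (fst f, snd e))"

definition rotate_at :: "(int \<Rightarrow> bool) \<Rightarrow> edge \<Rightarrow> edge set \<Rightarrow> edge set" where
  "rotate_at s f F = insert (snd f, fst f) (slide s f ` (F - {f}))"

text \<open>Whether \<open>(a,b)\<close> ascends or descends, compatibility with an ascending edge
  turns positive \<open>omega\<close> into scalar product -1, which leaves only head to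
  tail.\<close>

lemma slid_cases:
  assumes "compat s (a,b) (p,q)" "p < q" "a \<noteq> b" "omega s (a,b) (p,q) > 0"
  obtains "b = p" "a \<noteq> p" "a \<noteq> q" "omega s (a,b) (p,q) = 1" | "a = q" "b \<noteq> p" "b \<noteq> q" "omega s (a,b) (p,q) = 1"
proof -
  have 1: "omega s (a,b) (p,q) = 1" using assms(1,4) by (auto simp: compat_def)
  then have "sym_form (a,b) (p,q) = -1"
    using assms(1,2) omega_antisym[of s "(p,q)" "(a,b)"] by (cases "ascending (a,b)") (auto simp: compat_def ascending_def)
  then have "b = p \<and> a \<noteq> p \<and> a \<noteq> q \<or> a = q \<and> b \<noteq> p \<and> b \<noteq> q"
    using assms(2,3) by (auto simp: sym_form_def of_bool_def split: if_splits)
  then show ?thesis using that 1 by blast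
qed

text \<open>Provides the sides and signs that the locale \<open>rotation\<close> demands of the
  edges that stay.\<close>

lemma unslid_cases:
  assumes "compat s (a,b) (p,q)" "p < q" "a \<noteq> b" "omega s (a,b) (p,q) \<le> 0"
  obtains "b = p" "a < p" "\<not> s p" | "a = p" "b < p" "s p" | "b = q" "q < a" "\<not> s q" | "a = q" "q < b" "s q"
    | "sym_form (a,b) (p,q) = 0" "omega s (a,b) (p,q) = 0"
proof -
  have ne: "(a,b) \<noteq> (p,q)" "(a,b) \<noteq> (q,p)" using assms(1,2) not_compat_refl[of p q s] compat_sym by auto
  have "sym_form (a,b) (p,q) = 0" if "a \<noteq> p" "a \<noteq> q" "b \<noteq> p" "b \<noteq> q" using that by (simp add: sym_form_def)
  then consider "b = p" "a \<noteq> p" "a \<noteq> q" | "a = p" "b \<noteq> p" "b \<noteq> q" | "b = q" "a \<noteq> p" "a \<noteq> q" | "a = q" "b \<noteq> p" "b \<noteq> q"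
    | "sym_form (a,b) (p,q) = 0"
    using ne assms(3) by auto
  then show ?thesis
  proof cases
    case 1
    then have "\<not> cyclic s a p q" using assms(2,4) by (simp add: omega_head_tail split: if_splits)
    moreover have "(p < a \<and> a < q \<longrightarrow> \<not> s a) \<and> (q < a \<longrightarrow> s q)" 
      using assms(1,2) compat_head_tail[of a p q s] 1 by auto
    ultimately have "a < p \<and> \<not> s p" using 1 cyclic_less[OF assms(2), of a s] by auto
    then show ?thesis using that 1 by blast
  next
    case 2
    then have "b < p \<and> s p" using assms(1,2) compat_tail_tail[of b p q s] by auto
    then show ?thesis using that 2 by blast
  next
    case 3
    then have "q < a \<and> \<not> s q" using assms(1,2) compat_head_head[of a q p s] by auto
    then show ?thesis using that 3 by blast
  next
    case 4
    then have "cyclic s p q b" using assms(2,4) by (simp add: omega_tail_head split: if_splits)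
    moreover have "(p < b \<and> b < q \<longrightarrow> s b) \<and> (b < p \<longrightarrow> \<not> s p)" 
      using assms(1,2) compat_tail_head[of p q b s] 4 by auto
    ultimately have "q < b \<and> s q" using 4 assms(2) unfolding cyclic_def by (metis linorder_neqE order.strict_trans)
    then show ?thesis using that 4 by blast
  next
    case 5
    then have "omega s (a,b) (p,q) = 0" using assms(1) by (simp add: compat_def)
    then show ?thesis using that 5 by blast
  qed
qed

subsection \<open>Rotations preserve Cambrian trees\<close>

lemma slide_fixed: "omega s e f \<le> 0 \<Longrightarrow> slide s f e = e"
  by (simp add: slide_def)

lemma slide_head: "omega s (x,p) (p,q) > 0 \<Longrightarrow> slide s (p,q) (x,p) = (x,q)"
  by (simp add: slide_def)

lemma slide_tail: "omega s (q,y) (p,q) > 0 \<Longrightarrow> y \<noteq> p \<Longrightarrow> slide s (p,q) (q,y) = (p,y)"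
  by (simp add: slide_def)

lemma cyclic_rotate: "cyclic s p q x = cyclic s x p q"
  unfolding cyclic_def by blast

lemma omega_refl: "omega s e e = 0"
  using omega_antisym[of s e e] by simp

text \<open>At most one edge slides at each end of \<open>(p,q)\<close>: two edges into
  \<open>p\<close> lie on opposite sides of a negative vertex, and the one from the left does not
  slide; dually at \<open>q\<close>. If one slides at each end, the two changes of
  \<open>omega\<close> are 1 and -1.\<close>

lemma slide_compat:
  assumes c: "compat s (a,b) (p,q)" "compat s (c,d) (p,q)" "compat s (a,b) (c,d)"
    and "p < q" "a \<noteq> b" "c \<noteq> d"
  shows "compat s (slide s (p,q) (a,b)) (slide s (p,q) (c,d))"
proof -
  consider "omega s (a,b) (p,q) \<le> 0" "omega s (c,d) (p,q) \<le> 0" | "omega s (a,b) (p,q) > 0" "omega s (c,d) (p,q) \<le> 0"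
    | "omega s (a,b) (p,q) \<le> 0" "omega s (c,d) (p,q) > 0" | "omega s (a,b) (p,q) > 0" "omega s (c,d) (p,q) > 0"
    by linarith
  then show ?thesis
  proof cases
    case 1
    then show ?thesis using c by (simp add: slide_fixed)
  next
    case 2
    from c(1) assms(4,5) 2(1) show ?thesis
    proof (cases rule: slid_cases)
      case 1
      then show ?thesis
        using slide_head_compat[of p q a c d s] assms 2 by (simp add: slide_fixed slide_head)
    next
      case 2
      then show ?thesis
        using slide_tail_compat[of p q b c d s] assms \<open>omega s (c,d) (p,q) \<le> 0\<close> by (simp add: slide_fixed slide_tail)
    qed
  next
    case 3
    from c(2) assms(4,6) 3(2) have "compat s (slide s (p,q) (c,d)) (a,b)"
    proof (cases rule: slid_cases)
      case 1
      then show ?thesis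
        using slide_head_compat[of p q c a b s] assms 3 compat_sym[of s "(c,d)" "(a,b)"] by (simp add: slide_fixed slide_head)
    next
      case 2
      then show ?thesis
        using slide_tail_compat[of p q d a b s] assms 3 compat_sym[of s "(c,d)" "(a,b)"] by (simp add: slide_fixed slide_tail)
    qed
    then show ?thesis using 3 compat_sym by (simp add: slide_fixed)
  next
    case 4
    have hd: "cyclic s x p q" if "x \<noteq> p" "x \<noteq> q" "omega s (x,p) (p,q) = 1" for x
      using that assms(4) by (simp add: omega_head_tail split: if_splits)
    have tl: "\<not> cyclic s p q y" if "y \<noteq> p" "y \<noteq> q" "omega s (q,y) (p,q) = 1" for y
      using that assms(4) by (simp add: omega_tail_head split: if_splits)
    have ht: "compat s (x,q) (p,y)" if "x \<noteq> p" "x \<noteq> q" "omega s (x,p) (p,q) = 1" "y \<noteq> p" "y \<noteq> q" "omega s (q,y) (p,q) = 1" 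
      "compat s (x,p) (q,y)" for x y
    proof -
      have "x \<noteq> y" using hd[of x] tl[of y] that cyclic_rotate by metis
      then have sy0: "sym_form (x,p) (q,y) = 0" "sym_form (x,q) (p,y) = 0" using that assms(4) by (auto simp: sym_form_def)
      then have "omega s (x,p) (q,y) = 0" using that(7) by (simp add: compat_def)
      then have "omega s (x,q) (p,y) = 0"
        using that(3,6) omega_split1[of s x q _ p] omega_split2[of s _ p y q] omega_refl[of s "(p,q)"]
          omega_antisym[of s "(p,q)" "(q,y)"] by simp
      then show ?thesis using sy0 omega_antisym[of s "(p,y)" "(x,q)"] by (simp add: compat_def)
    qed
    from c(1) assms(4,5) 4(1) show ?thesis
    proof (cases rule: slid_cases)
      case 1
      note ab = 1
      from c(2) assms(4,6) 4(2) show ?thesis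
      proof (cases rule: slid_cases)
        case 1
        have "a \<noteq> c" using c(3) not_compat_refl[of a b s] assms(5) 1 ab by auto
        then have "\<not> s p" "a < p \<longleftrightarrow> p < c" using c(3) compat_head_head[of a p c s] 1 ab by auto
        then show ?thesis using hd[of a] hd[of c] ab 1 cyclic_less[OF assms(4), of a s] cyclic_less[OF assms(4), of c s] by force
      next
        case 2
        then show ?thesis using ht[of a d] ab c(3) by (simp add: slide_head slide_tail)
      qed
    next
      case 2
      note ab = 2
      from c(2) assms(4,6) 4(2) show ?thesis
      proof (cases rule: slid_cases)
        case 1
        then show ?thesis using ht[of c b] ab c(3) compat_sym[of s] by (simp add: slide_head slide_tail)
      next
        case 2
        have "b \<noteq> d" using c(3) not_compat_refl[of a b s] assms(5) 2 ab by auto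
        then have "s q" "b < q \<longleftrightarrow> q < d" using c(3) compat_tail_tail[of b q d s] 2 ab by auto
        moreover have "cyclic s p q y" if "q < y" "s q" for y using assms(4) that by (simp add: cyclic_def)
        ultimately have "cyclic s p q b \<or> cyclic s p q d" using 2 ab by (metis linorder_neqE)
        then show ?thesis using tl[of b] tl[of d] ab 2 by blast
      qed
    qed
  qed
qed

lemma slide_rev_compat:
  assumes c: "compat s (a,b) (p,q)" and "p < q" "a \<noteq> b"
  shows "compat s (slide s (p,q) (a,b)) (q,p)"
proof (cases "omega s (a,b) (p,q) \<le> 0")
  case True
  have ne: "(a,b) \<noteq> (p,q)" "(a,b) \<noteq> (q,p)" using assms(1,2) not_compat_refl[of p q s] compat_sym by auto
  have "compat s (a,b) (q,p)"
    using c assms(2,3) True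
  proof (cases rule: unslid_cases)
    case 5
    then show ?thesis
      using sym_form_rev1[of q p "(a,b)"] sym_form_sym[of "(a,b)"] omega_rev1[of s q p "(a,b)"] omega_antisym[of s "(a,b)"]
      by (simp add: compat_def)
  qed (use ne assms(2) in \<open>auto simp: compat_head_tail compat_head_head compat_tail_head compat_tail_tail\<close>)
  then show ?thesis by (simp add: slide_fixed True)
next
  case False
  then have "omega s (a,b) (p,q) > 0" by simp
  with c assms(2,3) show ?thesis
  proof (cases rule: slid_cases)
    case 1
    then have "cyclic s a p q" using assms(2) by (simp add: omega_head_tail split: if_splits)
    then show ?thesis using 1 c assms(2) cyclic_less[OF assms(2), of a s] compat_head_tail[of a q p s] 
      by (auto simp: slide_head)
  next
    case 2
    then have "\<not> cyclic s p q b" using assms(2) by (simp add: omega_tail_head split: if_splits)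
    moreover have "(p < b \<and> b < q \<longrightarrow> s b) \<and> (b < p \<longrightarrow> \<not> s p)"
      using compat_tail_head[of p q b s] c 2 assms(2) by auto
    ultimately have "(p < b \<and> b < q \<longrightarrow> s b) \<and> (q < b \<longrightarrow> \<not> s q)"
      using assms(2) unfolding cyclic_def by auto
    then show ?thesis using 2 c assms(2) compat_tail_head[of q p b s] 
      by (auto simp: slide_tail)
  qed
qed

text \<open>The invariant of reachable seeds: pairwise compatibility controls the exchange matrix,
  the forest and sidedness conditions control paths.\<close>

definition cambrian :: "(int \<Rightarrow> bool) \<Rightarrow> edge set \<Rightarrow> bool" where
  "cambrian s F \<longleftrightarrow> finite F \<and> (\<forall>e\<in>F. fst e \<noteq> snd e) \<and> (\<forall>e\<in>F. \<forall>f\<in>F. e \<noteq> f \<longrightarrow> compat s e f) \<and>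
     forest F \<and> in_sided s F \<and> out_sided s F"

lemma cambrian_compat: "cambrian s F \<Longrightarrow> e \<in> F \<Longrightarrow> f \<in> F \<Longrightarrow> e \<noteq> f \<Longrightarrow> compat s e f"
  by (simp add: cambrian_def)

lemma cambrian_rotation:
  assumes w: "cambrian s F" and e: "(p,q) \<in> F" "p < q"
  defines "X \<equiv> {x. (x,p) \<in> F \<and> omega s (x,p) (p,q) > 0}" and "Y \<equiv> {y. (q,y) \<in> F \<and> omega s (q,y) (p,q) > 0}"
  shows "rotation F s p q X Y"
proof
  have ne: "a \<noteq> b" if "(a,b) \<in> F" for a b using w that by (force simp: cambrian_def)
  show "forest F" "in_sided s F" "out_sided s F" using w by (auto simp: cambrian_def)
  then have nqp: "(q,p) \<notin> F" using forest_acyclic[of F p q] e by blast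
  have "finite F" using w by (simp add: cambrian_def)
  then have "finite (fst ` F)" "finite (snd ` F)" by auto
  moreover have "X \<subseteq> fst ` F" "Y \<subseteq> snd ` F" by (force simp: X_def Y_def)+
  ultimately show "finite X" "finite Y" by (meson finite_subset)+
  show "p < q" "(p,q) \<in> F" by fact+
  show "(x,p) \<in> F" if "x \<in> X" for x using that by (simp add: X_def)
  show "(q,y) \<in> F" if "y \<in> Y" for y using that by (simp add: Y_def)
  show "x < p \<and> \<not> s p" if "(x,p) \<in> F" "x \<notin> X" for x
  proof -
    have "(x,p) \<noteq> (p,q)" using ne e(1) by auto
    then have "compat s (x,p) (p,q)" using cambrian_compat[OF w] that e by blast
    moreover note e(2) ne[OF that(1)]
    moreover have "omega s (x,p) (p,q) \<le> 0" using that by (auto simp: X_def)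
    ultimately show ?thesis
    proof (cases rule: unslid_cases)
      case 5
      then show ?thesis using ne[OF that(1)] that nqp e(2) by (cases "x = q") (auto simp: sym_form_def)
    qed (use that nqp e(2) ne in auto)
  qed
  show "s p" if "x \<in> X" "x < p" for x
  proof -
    have "x \<noteq> q" using that nqp by (auto simp: X_def)
    then have "cyclic s x p q" using that e(2) omega_head_tail[of x p q s] by (simp add: X_def split: if_splits)
    then show ?thesis using that e(2) by (simp add: cyclic_def)
  qed
  show "z < p \<and> s p" if "(p,z) \<in> F" "z \<noteq> q" for z
    using cambrian_compat[OF w that(1) e(1)] compat_tail_tail[of z p q s] that ne[OF that(1)] e(2) by auto
  show "q < x \<and> \<not> s q" if "(x,q) \<in> F" "x \<noteq> p" for x
    using cambrian_compat[OF w that(1) e(1)] compat_head_head[of x q p s] that ne[OF that(1)] e(2) by auto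
  show "q < y \<and> s q" if "(q,y) \<in> F" "y \<notin> Y" for y
  proof -
    have "(q,y) \<noteq> (p,q)" using e(2) by auto
    then have "compat s (q,y) (p,q)" using cambrian_compat[OF w] that e by blast
    moreover note e(2) ne[OF that(1)]
    moreover have "omega s (q,y) (p,q) \<le> 0" using that by (auto simp: Y_def)
    ultimately show ?thesis
    proof (cases rule: unslid_cases)
      case 5
      then show ?thesis using ne[OF that(1)] that nqp e(2) by (cases "y = p") (auto simp: sym_form_def)
    qed (use that nqp e(2) ne in auto)
  qed
  show "\<not> s q" if "y \<in> Y" "q < y" for y
  proof -
    have "\<not> cyclic s p q y" using that e(2) omega_tail_head[of p q y s] by (simp add: Y_def split: if_splits)
    then show ?thesis using that e(2) by (simp add: cyclic_def)
  qed
qed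

text \<open>Joins the two descriptions of a mutation, by vectors and by re-hanging edges.\<close>

lemma rotate_at_eq_rotation:
  assumes w: "cambrian s F" and e: "(p,q) \<in> F" "p < q"
  shows "rotate_at s (p,q) F = rotation.F' F p q {x. (x,p) \<in> F \<and> omega s (x,p) (p,q) > 0} {y. (q,y) \<in> F \<and> omega s (q,y) (p,q) > 0}"
    (is "_ = rotation.F' F p q ?X ?Y")
proof -
  interpret rotation F s p q ?X ?Y by (rule cambrian_rotation[OF w e])
  have ne: "a \<noteq> b" if "(a,b) \<in> F" for a b using w that by (force simp: cambrian_def)
  have nqp: "(q,p) \<notin> F" using new_inversion(2) by auto
  have "(a,b) \<in> slide s (p,q) ` (F - {(p,q)}) \<longleftrightarrow> (a,b) \<in> F' - {(q,p)}" for a b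
  proof
    assume "(a,b) \<in> slide s (p,q) ` (F - {(p,q)})"
    then obtain c d where cd: "(c,d) \<in> F" "(c,d) \<noteq> (p,q)" "(a,b) = slide s (p,q) (c,d)" by auto
    have cp: "compat s (c,d) (p,q)" using cambrian_compat[OF w] cd e by blast
    show "(a,b) \<in> F' - {(q,p)}"
    proof (cases "omega s (c,d) (p,q) > 0")
      case True
      from cp e(2) ne[OF cd(1)] True show ?thesis
        by (cases rule: slid_cases) (use cd True in \<open>auto simp: slide_head slide_tail F'_iff\<close>)
    next
      case False
      then show ?thesis using cd nqp by (auto simp: slide_fixed F'_iff)
    qed
  next
    assume *: "(a,b) \<in> F' - {(q,p)}"
    then have "(a,b) \<in> F'" by simp
    then show "(a,b) \<in> slide s (p,q) ` (F - {(p,q)})"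
    proof (cases rule: F'_cases)
      case 2
      then show ?thesis using slide_head[of s a p q] e(2) by (intro image_eqI[of _ _ "(a,p)"]) auto
    next
      case 3
      then have "(q,b) \<in> F" "omega s (q,b) (p,q) > 0" "b \<noteq> p" using nqp by auto
      then show ?thesis using slide_tail[of s q b p] e(2) 3(1) by (intro image_eqI[of _ _ "(q,b)"]) auto
    next
      case 4
      have "omega s (a,b) (p,q) \<le> 0"
      proof (rule ccontr)
        assume "\<not> ?thesis"
        then have omega: "omega s (a,b) (p,q) > 0" by simp
        from cambrian_compat[OF w 4(1) e(1) 4(2)] e(2) ne[OF 4(1)] omega show False
          by (cases rule: slid_cases) (use 4 omega in auto)
      qed
      then show ?thesis using 4 by (intro image_eqI[of _ _ "(a,b)"]) (auto simp: slide_fixed)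
    qed (use * in auto)
  qed
  then have "slide s (p,q) ` (F - {(p,q)}) = F' - {(q,p)}" by auto
  then show ?thesis unfolding rotate_at_def by (auto simp: F'_iff)
qed

lemma cambrian_rotate_at:
  assumes w: "cambrian s F" and e: "f \<in> F" "ascending f"
  shows "cambrian s (rotate_at s f F)"
proof -
  obtain p q where f: "f = (p,q)" by (cases f)
  have e': "(p,q) \<in> F" "p < q" using e f by (auto simp: ascending_def)
  interpret rotation F s p q "{x. (x,p) \<in> F \<and> omega s (x,p) (p,q) > 0}" "{y. (q,y) \<in> F \<and> omega s (q,y) (p,q) > 0}"
    by (rule cambrian_rotation[OF w e'])
  note F' = rotate_at_eq_rotation[OF w e']
  have ne: "a \<noteq> b" if "(a,b) \<in> F" for a b using w that by (force simp: cambrian_def)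
  have "finite (rotate_at s f F)" using w by (simp add: cambrian_def rotate_at_def)
  moreover have "forest (rotate_at s f F)" "in_sided s (rotate_at s f F)" "out_sided s (rotate_at s f F)"
    using forest' in_sided' out_sided' by (simp_all add: f F')
  moreover have "compat s u v" if "u \<in> rotate_at s f F" "v \<in> rotate_at s f F" "u \<noteq> v" for u v
  proof -
    have sl: "compat s (slide s f u) (slide s f v)" if "u \<in> F - {f}" "v \<in> F - {f}" "u \<noteq> v" for u v
      using slide_compat[of s "fst u" "snd u" p q "fst v" "snd v"] that cambrian_compat[OF w] e e'(2) f ne[of "fst u" "snd u"] ne[of "fst v" "snd v"] 
      by simp
    have rv: "compat s (slide s f u) (q,p)" if "u \<in> F - {f}" for u
      using slide_rev_compat[of s "fst u" "snd u" p q] that cambrian_compat[OF w] e e'(2) f ne[of "fst u" "snd u"] by simp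
    have "u = (q,p) \<or> (\<exists>u'\<in>F - {f}. u = slide s f u')" "v = (q,p) \<or> (\<exists>v'\<in>F - {f}. v = slide s f v')"
      using that by (auto simp: rotate_at_def f)
    then show ?thesis using sl rv compat_sym[of s] that(3) by metis
  qed
  moreover have "fst u \<noteq> snd u" if "u \<in> rotate_at s f F" for u
  proof -
    have "fst (slide s f v) \<noteq> snd (slide s f v)" if "v \<in> F - {f}" for v
    proof (cases "omega s v f > 0")
      case True
      obtain a b where v: "v = (a,b)" by (cases v)
      have "compat s (a,b) (p,q)" using cambrian_compat[OF w] that e f v by auto
      then show ?thesis using e'(2) ne[of a b] True[unfolded v f]
        by (cases rule: slid_cases) (use that v f True in \<open>auto simp: slide_head slide_tail\<close>)
    next
      case False
      then show ?thesis using that ne[of "fst v" "snd v"] by (simp add: slide_fixed)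
    qed
    then show ?thesis using that e'(2) unfolding rotate_at_def f by auto
  qed
  ultimately show ?thesis unfolding cambrian_def by blast
qed

subsection \<open>Squares and pentagons\<close>

definition rev_edge :: "edge \<Rightarrow> edge" where "rev_edge f = (snd f, fst f)"

text \<open>The root of an edge. A slide adds roots, so equality of composed slides becomes linear
  arithmetic.\<close>

definition edge_vec :: "edge \<Rightarrow> int \<Rightarrow> int" where
  "edge_vec e v = of_bool (fst e = v) - of_bool (snd e = v)"

lemma edge_vec_inject:
  assumes "edge_vec e = edge_vec f" "fst e \<noteq> snd e" "fst f \<noteq> snd f" shows "e = f"
proof -
  have "edge_vec e (fst e) = edge_vec f (fst e)" "edge_vec e (snd e) = edge_vec f (snd e)" using assms(1) by simp_all
  then have "fst e = fst f" "snd e = snd f" using assms(2,3) by (auto simp: edge_vec_def of_bool_def split: if_splits)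
  then show ?thesis by (simp add: prod_eq_iff)
qed

lemma cambrian_nondegenerate: "cambrian s F \<Longrightarrow> e \<in> F \<Longrightarrow> fst e \<noteq> snd e"
  by (simp add: cambrian_def)

lemma cambrian_slid:
  assumes "cambrian s F" "e \<in> F" "f \<in> F" "e \<noteq> f" "ascending f" "omega s e f > 0"
  shows "snd e = fst f \<and> slide s f e = (fst e, snd f) \<or> fst e = snd f \<and> slide s f e = (fst f, snd e)"
proof -
  obtain a b p q where ef: "e = (a,b)" "f = (p,q)" by (cases e, cases f)
  have "compat s (a,b) (p,q)" "p < q" "a \<noteq> b" "omega s (a,b) (p,q) > 0"
    using assms cambrian_compat[OF assms(1-4)] cambrian_nondegenerate[OF assms(1,2)] by (auto simp: ef ascending_def)
  then show ?thesis
    by (cases rule: slid_cases) (use assms(6) in \<open>auto simp: ef slide_head slide_tail\<close>)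
qed

lemma edge_vec_slide:
  assumes "cambrian s F" "e \<in> F" "f \<in> F" "e \<noteq> f" "ascending f"
  shows "edge_vec (slide s f e) v = edge_vec e v + (if omega s e f > 0 then edge_vec f v else 0)"
  using cambrian_slid[OF assms] by (auto simp: edge_vec_def slide_def)

lemma omega_slide:
  assumes "cambrian s F" "e \<in> F" "f \<in> F" "e \<noteq> f" "ascending f"
  shows "omega s (slide s f e) g = omega s e g + (if omega s e f > 0 then omega s f g else 0)"
  using cambrian_slid[OF assms] by (auto simp: omega_def slide_def)

lemma omega_rev: "omega s (rev_edge f) g = - omega s f g" "omega s f (rev_edge g) = - omega s f g"
  by (simp_all add: omega_def rev_edge_def)

lemma rotate_at_insert: "g \<notin> A \<Longrightarrow> rotate_at s g (insert g A) = insert (rev_edge g) (slide s g ` A)"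
  by (simp add: rotate_at_def rev_edge_def)

lemma cambrian_omega_le: "cambrian s F \<Longrightarrow> e \<in> F \<Longrightarrow> f \<in> F \<Longrightarrow> e \<noteq> f \<Longrightarrow> \<bar>omega s e f\<bar> \<le> 1"
  using cambrian_compat[of s F e f] by (simp add: compat_def)

lemma slide_neq_rev:
  assumes w: "cambrian s F" and e: "e \<in> F" "f \<in> F" "e \<noteq> f" "ascending f"
  shows "slide s f e \<noteq> rev_edge f"
proof -
  obtain p q where f: "f = (p,q)" "p < q" using e(4) by (cases f) (auto simp: ascending_def)
  show ?thesis
    using slide_rev_compat[of s "fst e" "snd e" p q] cambrian_compat[OF w e(1-3)] cambrian_nondegenerate[OF w e(1)]
      not_compat_refl(1)[of q p s] f by (auto simp: rev_edge_def)
qed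

text \<open>Slid edges stay pairwise compatible, and no edge is compatible with itself. Hence a
  second rotation can be computed edge by edge, and labellings stay injective.\<close>

lemma slide_notin:
  assumes w: "cambrian s F" and F: "F = insert f (insert g R)" "f \<notin> R" "g \<notin> R" "f \<noteq> g" "ascending f"
  shows "slide s f g \<notin> insert (rev_edge f) (slide s f ` R)"
proof -
  obtain p q where f: "f = (p,q)" "p < q" using F(5) by (cases f) (auto simp: ascending_def)
  have wm: "cambrian s (rotate_at s f F)" using cambrian_rotate_at[OF w _ F(5)] F(1) by simp
  have c: "compat s a f" if "a \<in> insert g R" for a using cambrian_compat[OF w, of a f] that F by auto
  have nd: "fst a \<noteq> snd a" if "a \<in> insert g R" for a using cambrian_nondegenerate[OF w, of a] that F by auto
  have nds: "fst (slide s f g) \<noteq> snd (slide s f g)" 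
    using cambrian_nondegenerate[OF wm] F by (auto simp: rotate_at_def)
  have "slide s f g \<noteq> rev_edge f"
    using slide_neq_rev[OF w, of g f] F by auto
  moreover have "slide s f g \<noteq> slide s f a" if "a \<in> R" for a
  proof
    assume eq: "slide s f g = slide s f a"
    have "compat s g a" using cambrian_compat[OF w, of g a] that F by auto
    then have "compat s (slide s f g) (slide s f a)"
      using slide_compat[of s "fst g" "snd g" p q "fst a" "snd a"] c[of g] c[of a] nd[of g] nd[of a] that f by simp
    then show False using eq nds not_compat_refl(1)[of "fst (slide s f g)" "snd (slide s f g)" s] by simp
  qed
  ultimately show ?thesis by auto
qed

lemma rotate_at_two:
  assumes w: "cambrian s F" and F: "F = insert f (insert g R)" "f \<notin> R" "g \<notin> R" "f \<noteq> g" "ascending f"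
  shows "rotate_at s f F = insert (slide s f g) (insert (rev_edge f) (slide s f ` R))"
    "slide s f g \<notin> insert (rev_edge f) (slide s f ` R)"
    "rotate_at s (slide s f g) (rotate_at s f F) = insert (rev_edge (slide s f g)) (insert (slide s (slide s f g) (rev_edge f)) (slide s (slide s f g) ` slide s f ` R))"
proof -
  show 1: "rotate_at s f F = insert (slide s f g) (insert (rev_edge f) (slide s f ` R))"
    using rotate_at_insert[of f "insert g R" s] F by auto
  show 2: "slide s f g \<notin> insert (rev_edge f) (slide s f ` R)" by (rule slide_notin[OF assms])
  show "rotate_at s (slide s f g) (rotate_at s f F) = insert (rev_edge (slide s f g)) (insert (slide s (slide s f g) (rev_edge f)) (slide s (slide s f g) ` slide s f ` R))"
    unfolding 1 rotate_at_insert[OF 2] by simp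
qed

text \<open>As \<open>omega s f g = 0\<close>, sliding along one edge does not change
  \<open>omega\<close> against the other, so both edges are added under the same conditions in
  either order.\<close>

lemma square:
  assumes w: "cambrian s F" and fg: "f \<in> F" "g \<in> F" "ascending f" "ascending g" "f \<noteq> g" "omega s f g = 0"
  shows "slide s f g = g" "slide s g f = f" "rotate_at s g (rotate_at s f F) = rotate_at s f (rotate_at s g F)"
proof -
  have gf: "omega s g f = 0" using fg omega_antisym[of s f g] by simp
  show sl: "slide s f g = g" "slide s g f = f" using fg gf by (simp_all add: slide_fixed)
  define R where "R = F - {f,g}"
  have F: "F = insert f (insert g R)" "f \<notin> R" "g \<notin> R" using fg by (auto simp: R_def)
  have F': "F = insert g (insert f R)" using F by auto
  have wf: "cambrian s (rotate_at s f F)" and wg: "cambrian s (rotate_at s g F)" using cambrian_rotate_at[OF w] fg by auto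
  note A = rotate_at_two[OF w F fg(5,3), unfolded sl] and B = rotate_at_two[OF w F' F(3,2) fg(5)[symmetric] fg(4), unfolded sl]
  have [simp]: "slide s g (rev_edge f) = rev_edge f" "slide s f (rev_edge g) = rev_edge g"
    using fg gf omega_rev by (simp_all add: slide_fixed)
  have eq: "slide s g (slide s f e) = slide s f (slide s g e)" if e: "e \<in> R" for e
  proof (rule edge_vec_inject)
    have eF: "e \<in> F" "e \<noteq> f" "e \<noteq> g" using e by (auto simp: R_def)
    have in1: "slide s f e \<in> rotate_at s f F" "g \<in> rotate_at s f F" "slide s f e \<noteq> g" using A(1,2) e by auto
    have in2: "slide s g e \<in> rotate_at s g F" "f \<in> rotate_at s g F" "slide s g e \<noteq> f" using B(1,2) e by auto
    show "edge_vec (slide s g (slide s f e)) = edge_vec (slide s f (slide s g e))"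
      using edge_vec_slide[OF wf in1 fg(4)] edge_vec_slide[OF wg in2 fg(3)]
        edge_vec_slide[OF w eF(1) fg(1) eF(2) fg(3)] edge_vec_slide[OF w eF(1) fg(2) eF(3) fg(4)]
        omega_slide[OF w eF(1) fg(1) eF(2) fg(3), of g] omega_slide[OF w eF(1) fg(2) eF(3) fg(4), of f] fg(6) gf
      by (auto simp: fun_eq_iff)
    have "slide s g (slide s f e) \<in> rotate_at s g (rotate_at s f F)" "slide s f (slide s g e) \<in> rotate_at s f (rotate_at s g F)"
      using A(3) B(3) e by auto
    then show "fst (slide s g (slide s f e)) \<noteq> snd (slide s g (slide s f e))" 
      "fst (slide s f (slide s g e)) \<noteq> snd (slide s f (slide s g e))"
      using cambrian_nondegenerate[OF cambrian_rotate_at[OF wf in1(2) fg(4)]] cambrian_nondegenerate[OF cambrian_rotate_at[OF wg in2(2) fg(3)]] by auto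
  qed
  have "slide s g ` slide s f ` R = slide s f ` slide s g ` R"
    unfolding image_image using eq by (intro image_cong) auto
  then show "rotate_at s g (rotate_at s f F) = rotate_at s f (rotate_at s g F)"
    unfolding A(3) B(3) by auto
qed

text \<open>The root of \<open>h\<close> is the sum of those of \<open>f\<close> and
  \<open>g\<close>. The short side rotates at \<open>f\<close>, \<open>g\<close>, the long one at
  \<open>g\<close>, \<open>h\<close>, \<open>f\<close>.\<close>

lemma pentagon:
  assumes w: "cambrian s F" and fg: "f \<in> F" "g \<in> F" "ascending f" "ascending g" "f \<noteq> g" "omega s f g = 1"
  defines "h \<equiv> slide s g f"
  shows "slide s f g = g" "ascending h" "h \<in> rotate_at s g F" "f \<in> rotate_at s h (rotate_at s g F)" "g \<in> rotate_at s f F"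
    "rotate_at s g (rotate_at s f F) = rotate_at s f (rotate_at s h (rotate_at s g F))"
proof -
  have gf: "omega s g f = -1" using fg omega_antisym[of s f g] by simp
  show sl: "slide s f g = g" using gf by (simp add: slide_fixed)
  define R where "R = F - {f,g}"
  have F: "F = insert f (insert g R)" "f \<notin> R" "g \<notin> R" using fg by (auto simp: R_def)
  have F': "F = insert g (insert f R)" using F by auto
  have wf: "cambrian s (rotate_at s f F)" and wg: "cambrian s (rotate_at s g F)" using cambrian_rotate_at[OF w] fg by auto
  note A = rotate_at_two[OF w F fg(5,3), unfolded sl] and B = rotate_at_two[OF w F' F(3,2) fg(5)[symmetric] fg(4), folded h_def]
  show gF: "g \<in> rotate_at s f F" using A(1) by simp
  show hG: "h \<in> rotate_at s g F" using B(1) by simp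
  have hfg: "snd f = fst g \<and> h = (fst f, snd g) \<or> fst f = snd g \<and> h = (fst g, snd f)"
    using cambrian_slid[OF w fg(1,2,5,4)] fg(6) by (simp add: h_def)
  then show grh: "ascending h" using fg(3,4) by (auto simp: ascending_def)
  have omega_h: "omega s e h = omega s e f + omega s e g" "omega s h e = omega s f e + omega s g e" for e
    using hfg by (auto simp: omega_def)
  have edge_vec_h: "edge_vec h v = edge_vec f v + edge_vec g v" for v using hfg by (auto simp: edge_vec_def)
  have nf: "fst f \<noteq> snd f" "fst g \<noteq> snd g" using fg(3,4) by (auto simp: ascending_def)
  \<comment> \<open>In roots: \<open>- g + h = f\<close>; below, \<open>- h + f = - g\<close>. On
    the long side \<open>f\<close> and \<open>g\<close> thus exchange their places.\<close>
  have rg: "slide s h (rev_edge g) = f"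
  proof -
    have "omega s (rev_edge g) h = 1" using omega_rev(1)[of s g h] omega_h(1)[of g] gf omega_refl[of s g] by simp
    then show ?thesis
      using hfg
    proof (elim disjE conjE)
      assume "snd f = fst g" "h = (fst f, snd g)"
      then show ?thesis using \<open>omega s (rev_edge g) h = 1\<close> nf by (simp add: slide_def rev_edge_def prod_eq_iff)
    next
      assume "fst f = snd g" "h = (fst g, snd f)"
      then show ?thesis using \<open>omega s (rev_edge g) h = 1\<close> nf by (simp add: slide_def rev_edge_def prod_eq_iff)
    qed
  qed
  have wh: "cambrian s (rotate_at s h (rotate_at s g F))" using cambrian_rotate_at[OF wg hG grh] .
  show fH: "f \<in> rotate_at s h (rotate_at s g F)" unfolding B(3) rg by simp
  have rh: "slide s f (rev_edge h) = rev_edge g"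
  proof -
    have "omega s (rev_edge h) f = 1" using omega_rev(1)[of s h f] omega_h(2)[of f] gf omega_refl[of s f] by simp
    then show ?thesis
      using hfg
    proof (elim disjE conjE)
      assume "snd f = fst g" "h = (fst f, snd g)"
      then show ?thesis using \<open>omega s (rev_edge h) f = 1\<close> nf by (simp add: slide_def rev_edge_def prod_eq_iff)
    next
      assume "fst f = snd g" "h = (fst g, snd f)"
      then show ?thesis using \<open>omega s (rev_edge h) f = 1\<close> nf by (simp add: slide_def rev_edge_def prod_eq_iff)
    qed
  qed
  have C: "rotate_at s h (rotate_at s g F) = insert f (insert (rev_edge h) (slide s h ` slide s g ` R))"
    "f \<notin> insert (rev_edge h) (slide s h ` slide s g ` R)"
  proof -
    have rgn: "rev_edge g \<notin> slide s g ` R"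
    proof
      assume "rev_edge g \<in> slide s g ` R"
      then obtain e where "e \<in> R" "slide s g e = rev_edge g" by force
      then show False using slide_neq_rev[OF w _ fg(2) _ fg(4), of e] by (simp add: R_def)
    qed
    show "rotate_at s h (rotate_at s g F) = insert f (insert (rev_edge h) (slide s h ` slide s g ` R))"
      unfolding B(3) rg by auto
    show "f \<notin> insert (rev_edge h) (slide s h ` slide s g ` R)"
      using slide_notin[OF wg B(1) _ rgn _ grh] B(2) rg by auto
  qed
  have rf: "slide s g (rev_edge f) = rev_edge f" using fg(6) omega_rev by (simp add: slide_fixed)
  have D: "rotate_at s f (rotate_at s h (rotate_at s g F)) = insert (rev_edge f) (insert (rev_edge g) (slide s f ` slide s h ` slide s g ` R))"
    unfolding C(1) rotate_at_insert[OF C(2)] by (simp add: rh)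
  have eq: "slide s g (slide s f e) = slide s f (slide s h (slide s g e))" if e: "e \<in> R" for e
  proof (rule edge_vec_inject)
    have eF: "e \<in> F" "e \<noteq> f" "e \<noteq> g" using e by (auto simp: R_def)
    have in1: "slide s f e \<in> rotate_at s f F" "g \<in> rotate_at s f F" "slide s f e \<noteq> g" using A(1,2) e by auto
    have in2: "slide s g e \<in> rotate_at s g F" "h \<in> rotate_at s g F" "slide s g e \<noteq> h" using B(1,2) e by auto
    have in3: "slide s h (slide s g e) \<in> rotate_at s h (rotate_at s g F)" "slide s h (slide s g e) \<noteq> f" using C e by auto
    \<comment> \<open>The first bound excludes \<open>omega s e f = omega s e g = 1\<close>, the
      only combination for which the two sides would disagree.\<close>
    have small: "omega s (slide s f e) g \<le> 1" "\<bar>omega s e f\<bar> \<le> 1" "\<bar>omega s e g\<bar> \<le> 1"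
      using cambrian_omega_le[OF wf in1] cambrian_omega_le[OF w eF(1) fg(1) eF(2)] cambrian_omega_le[OF w eF(1) fg(2) eF(3)] by linarith+
    have x: "omega s e f = -1 \<or> omega s e f = 0 \<or> omega s e f = 1" and y: "omega s e g = -1 \<or> omega s e g = 0 \<or> omega s e g = 1"
      using small by linarith+
    have o1: "omega s (slide s f e) g = omega s e g + (if omega s e f > 0 then 1 else 0)"
      using omega_slide[OF w eF(1) fg(1) eF(2) fg(3), of g] fg(6) by simp
    have o2: "omega s (slide s g e) f = omega s e f + (if omega s e g > 0 then -1 else 0)"
      "omega s (slide s g e) g = omega s e g"
      using omega_slide[OF w eF(1) fg(2) eF(3) fg(4), of f] omega_slide[OF w eF(1) fg(2) eF(3) fg(4), of g] gf omega_refl[of s g]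
      by (simp_all split: if_splits)
    have o3: "omega s (slide s h (slide s g e)) f = omega s (slide s g e) f + (if omega s (slide s g e) h > 0 then -1 else 0)"
      using omega_slide[OF wg in2 grh, of f] omega_h(2)[of f] gf omega_refl[of s f] by simp
    show "edge_vec (slide s g (slide s f e)) = edge_vec (slide s f (slide s h (slide s g e)))"
    proof
      fix v
      show "edge_vec (slide s g (slide s f e)) v = edge_vec (slide s f (slide s h (slide s g e))) v"
        unfolding edge_vec_slide[OF wf in1 fg(4)] edge_vec_slide[OF wh in3(1) fH in3(2) fg(3)] edge_vec_slide[OF wg in2 grh]
          edge_vec_slide[OF w eF(1) fg(1) eF(2) fg(3)] edge_vec_slide[OF w eF(1) fg(2) eF(3) fg(4)] o3 omega_h(1) o1 o2 edge_vec_h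
        using small(1)[unfolded o1] x y by (elim disjE) simp_all
    qed
    have "slide s g (slide s f e) \<in> rotate_at s g (rotate_at s f F)" "slide s f (slide s h (slide s g e)) \<in> rotate_at s f (rotate_at s h (rotate_at s g F))"
      using A(3) D e by auto
    then show "fst (slide s g (slide s f e)) \<noteq> snd (slide s g (slide s f e))" 
      "fst (slide s f (slide s h (slide s g e))) \<noteq> snd (slide s f (slide s h (slide s g e)))"
      using cambrian_nondegenerate[OF cambrian_rotate_at[OF wf in1(2) fg(4)]] cambrian_nondegenerate[OF cambrian_rotate_at[OF wh fH fg(3)]] by auto
  qed
  have "slide s g ` slide s f ` R = slide s f ` slide s h ` slide s g ` R"
    unfolding image_image using eq by (intro image_cong) auto
  then show "rotate_at s g (rotate_at s f F) = rotate_at s f (rotate_at s h (rotate_at s g F))"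
    unfolding A(3) D rf by auto
qed

subsection \<open>Lengths of maximal chains\<close>

definition terminal :: "edge set \<Rightarrow> bool" where
  "terminal F \<longleftrightarrow> (\<forall>f\<in>F. \<not> ascending f)"

definition step :: "(int \<Rightarrow> bool) \<Rightarrow> edge set \<Rightarrow> edge set \<Rightarrow> bool" where
  "step s F F' \<longleftrightarrow> (\<exists>f\<in>F. ascending f \<and> F' = rotate_at s f F)"

definition chain_lengths :: "(int \<Rightarrow> bool) \<Rightarrow> edge set \<Rightarrow> nat set" where
  "chain_lengths s F = {l. \<exists>F'. (step s ^^ l) F F' \<and> terminal F'}"

definition inversions :: "nat \<Rightarrow> edge set \<Rightarrow> edge set" where
  "inversions n F = {(a,b). 0 \<le> a \<and> a < b \<and> b \<le> int n \<and> (b,a) \<in> F\<^sup>*}"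

definition verts :: "nat \<Rightarrow> edge set \<Rightarrow> bool" where
  "verts n F \<longleftrightarrow> F \<subseteq> {0..int n} \<times> {0..int n}"

lemma card_pairs: "card {(a,b). 0 \<le> a \<and> a < b \<and> b \<le> int n} = n * (n + 1) div 2"
  and finite_pairs: "finite {(a,b). 0 \<le> a \<and> a < b \<and> b \<le> int n}"
proof -
  have eq: "{(a,b). 0 \<le> a \<and> a < b \<and> b \<le> int n} = (\<lambda>(b,a). (a,b)) ` (SIGMA b:{0..int n}. {0..<b})"
    by force
  show "finite {(a,b). 0 \<le> a \<and> a < b \<and> b \<le> int n}" unfolding eq by auto
  have "card (SIGMA b:{0..int n}. {0..<b}) = (\<Sum>b=0..int n. nat b)" by simp
  also have "\<dots> = (\<Sum>k=0..n. k)"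
    by (rule sum.reindex_bij_witness[of _ int nat]) auto
  also have "\<dots> = n * (n + 1) div 2" by (simp add: Sum_Icc_nat)
  finally show "card {(a,b). 0 \<le> a \<and> a < b \<and> b \<le> int n} = n * (n + 1) div 2"
    unfolding eq by (subst card_image) (auto simp: inj_on_def)
qed

lemma finite_inversions: "finite (inversions n F)"
  by (rule finite_subset[OF _ finite_pairs[of n]]) (auto simp: inversions_def)

lemma card_inversions_le: "card (inversions n F) \<le> n * (n + 1) div 2"
  unfolding card_pairs[symmetric] by (rule card_mono[OF finite_pairs]) (auto simp: inversions_def)

lemma slide_verts: "e \<in> A \<times> A \<Longrightarrow> f \<in> A \<times> A \<Longrightarrow> slide s f e \<in> A \<times> A"
  by (auto simp: slide_def)

lemma verts_rotate_at: "verts n F \<Longrightarrow> f \<in> F \<Longrightarrow> verts n (rotate_at s f F)"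
proof -
  assume v: "verts n F" and f: "f \<in> F"
  let ?A = "{0..int n}"
  have F: "e \<in> ?A \<times> ?A" if "e \<in> F" for e using that v unfolding verts_def by blast
  have "slide s f e \<in> ?A \<times> ?A" if "e \<in> F" for e by (rule slide_verts[OF F[OF that] F[OF f]])
  moreover have "(snd f, fst f) \<in> ?A \<times> ?A" using F[OF f] by (simp add: mem_Times_iff)
  ultimately show ?thesis unfolding verts_def rotate_at_def by blast
qed

lemma inversions_rotate_at:
  assumes w: "cambrian s F" and v: "verts n F" and f: "f \<in> F" "ascending f"
  shows "card (inversions n F) < card (inversions n (rotate_at s f F))"
proof -
  obtain p q where pq: "f = (p,q)" by (cases f)
  have e: "(p,q) \<in> F" "p < q" using f pq by (auto simp: ascending_def)
  interpret rotation F s p q "{x. (x,p) \<in> F \<and> omega s (x,p) (p,q) > 0}" "{y. (q,y) \<in> F \<and> omega s (q,y) (p,q) > 0}"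
    by (rule cambrian_rotation[OF w e])
  have F': "rotate_at s f F = F'" using rotate_at_eq_rotation[OF w e] pq by simp
  have "inversions n F \<subseteq> inversions n (rotate_at s f F)"
    unfolding F' inversions_def using inversions_preserved by auto
  moreover have "(p,q) \<in> inversions n (rotate_at s f F)" "(p,q) \<notin> inversions n F"
    using new_inversion e v unfolding F' inversions_def verts_def by auto
  ultimately show ?thesis by (intro psubset_card_mono finite_inversions) auto
qed

section \<open>First steps, the upper bound and the interval property\<close>

lemma chain_lengths_terminal: "terminal F \<Longrightarrow> chain_lengths s F = {0}"
proof -
  assume t: "terminal F"
  have "l = 0" if "(step s ^^ l) F F'" for l F'
  proof (cases l)
    case (Suc k)
    then obtain G where "step s F G" using \<open>(step s ^^ l) F F'\<close> by (metis relpowp_Suc_D2)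
    then show ?thesis using t by (auto simp: step_def terminal_def)
  qed
  then show ?thesis using t unfolding chain_lengths_def by force
qed

lemma chain_lengths_SucI: "f \<in> F \<Longrightarrow> ascending f \<Longrightarrow> l \<in> chain_lengths s (rotate_at s f F) \<Longrightarrow> Suc l \<in> chain_lengths s F"
  unfolding chain_lengths_def using relpowp_Suc_I2[of "step s" F "rotate_at s f F" l] by (auto simp: step_def simp del: relpowp.simps)

lemma chain_lengths_cases:
  assumes "l \<in> chain_lengths s F" "\<not> terminal F"
  obtains f k where "f \<in> F" "ascending f" "l = Suc k" "k \<in> chain_lengths s (rotate_at s f F)"
proof -
  obtain F' where F': "(step s ^^ l) F F'" "terminal F'" using assms(1) by (auto simp: chain_lengths_def)
  with assms(2) obtain k where k: "l = Suc k" by (cases l) auto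
  obtain G where "step s F G" "(step s ^^ k) G F'" using F'(1) unfolding k by (metis relpowp_Suc_D2)
  then show ?thesis using that F' k by (auto simp: step_def chain_lengths_def)
qed

lemma chain_lengths_le:
  assumes "cambrian s F" "verts n F" "(step s ^^ l) F F'"
  shows "card (inversions n F) + l \<le> card (inversions n F') \<and> cambrian s F' \<and> verts n F'"
  using assms(3)
proof (induction l arbitrary: F')
  case (Suc l)
  then obtain G where G: "(step s ^^ l) F G" "step s G F'" by auto
  then obtain f where f: "f \<in> G" "ascending f" "F' = rotate_at s f G" by (auto simp: step_def)
  have IH: "card (inversions n F) + l \<le> card (inversions n G)" "cambrian s G" "verts n G" using Suc.IH[OF G(1)] by auto
  show ?case using IH inversions_rotate_at[OF IH(2,3) f(1,2)] cambrian_rotate_at[OF IH(2) f(1,2)] verts_rotate_at[OF IH(3) f(1)] f(3) by auto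
qed (use assms in auto)

lemma chain_lengths_upper: "cambrian s F \<Longrightarrow> verts n F \<Longrightarrow> l \<in> chain_lengths s F \<Longrightarrow> l \<le> n * (n + 1) div 2"
proof -
  assume "cambrian s F" "verts n F" "l \<in> chain_lengths s F"
  then obtain F' where "(step s ^^ l) F F'" by (auto simp: chain_lengths_def)
  then show ?thesis using chain_lengths_le[of s F n l F'] \<open>cambrian s F\<close> \<open>verts n F\<close> card_inversions_le[of n F'] by linarith
qed

lemma chain_lengths_interval:
  assumes "cambrian s F" "verts n F"
  shows "chain_lengths s F \<noteq> {} \<and> (\<forall>a\<in>chain_lengths s F. \<forall>b\<in>chain_lengths s F. \<forall>c. a \<le> c \<longrightarrow> c \<le> b \<longrightarrow> c \<in> chain_lengths s F)"
  using assms
proof (induction "n * (n + 1) div 2 - card (inversions n F)" arbitrary: F rule: less_induct)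
  case less
  note w = \<open>cambrian s F\<close> and v = \<open>verts n F\<close>
  show ?case
  proof (cases "terminal F")
    case True
    then show ?thesis by (simp add: chain_lengths_terminal)
  next
    case False
    have IH0: "chain_lengths s G \<noteq> {} \<and> (\<forall>a\<in>chain_lengths s G. \<forall>b\<in>chain_lengths s G. \<forall>c. a \<le> c \<longrightarrow> c \<le> b \<longrightarrow> c \<in> chain_lengths s G)"
      if "cambrian s G" "verts n G" "card (inversions n F) < card (inversions n G)" for G
    proof (rule less.hyps[OF _ that(1,2)])
      show "n * (n + 1) div 2 - card (inversions n G) < n * (n + 1) div 2 - card (inversions n F)"
        using that(3) card_inversions_le[of n G] by linarith
    qed
    have IH: "chain_lengths s (rotate_at s f F) \<noteq> {}"
      "a \<in> chain_lengths s (rotate_at s f F) \<Longrightarrow> b \<in> chain_lengths s (rotate_at s f F) \<Longrightarrow> a \<le> c \<Longrightarrow> c \<le> b \<Longrightarrow> c \<in> chain_lengths s (rotate_at s f F)"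
      if f: "f \<in> F" "ascending f" for f a b c
      using IH0[OF cambrian_rotate_at[OF w f] verts_rotate_at[OF v f(1)] inversions_rotate_at[OF w v f]] by blast+
    obtain f0 where f0: "f0 \<in> F" "ascending f0" using False by (auto simp: terminal_def)
    have ne: "chain_lengths s F \<noteq> {}" using IH(1)[OF f0] chain_lengths_SucI[OF f0] by blast
    have nonempty: "\<exists>m. m \<in> chain_lengths s (rotate_at s g (rotate_at s f F))" if g: "g \<in> rotate_at s f F" "ascending g" and f: "f \<in> F" "ascending f" for f g
    proof -
      note wf = cambrian_rotate_at[OF w f] and vf = verts_rotate_at[OF v f(1), of s]
      have "card (inversions n F) < card (inversions n (rotate_at s g (rotate_at s f F)))"
        using inversions_rotate_at[OF w v f] inversions_rotate_at[OF wf vf g] by linarith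
      then show ?thesis using IH0[OF cambrian_rotate_at[OF wf g] verts_rotate_at[OF vf g(1)]] by blast
    qed
    \<comment> \<open>After any two first steps there are completions whose lengths differ by at
      most one, so the two intervals of lengths overlap or are adjacent.\<close>
    have near: "\<exists>m1 m2. m1 \<in> chain_lengths s (rotate_at s f F) \<and> m2 \<in> chain_lengths s (rotate_at s g F) \<and> m1 \<le> m2 + 1 \<and> m2 \<le> m1 + 1"
      if fg: "f \<in> F" "ascending f" "g \<in> F" "ascending g" for f g
    proof -
      have pent: "\<exists>m. Suc m \<in> chain_lengths s (rotate_at s f F) \<and> Suc (Suc m) \<in> chain_lengths s (rotate_at s g F)"
        if fg: "f \<in> F" "ascending f" "g \<in> F" "ascending g" and "f \<noteq> g" "omega s f g = 1" for f g
      proof -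
        note P = pentagon[OF w fg(1,3,2,4) that(5,6)]
        obtain m where m: "m \<in> chain_lengths s (rotate_at s g (rotate_at s f F))" using nonempty[OF P(5) fg(4) fg(1,2)] by blast
        then have "Suc (Suc m) \<in> chain_lengths s (rotate_at s g F)"
          unfolding P(6) using chain_lengths_SucI P(2-4) fg(2) by blast
        then show ?thesis using chain_lengths_SucI[OF P(5) fg(4) m] by blast
      qed
      show ?thesis
      proof (cases "f = g")
        case True
        then show ?thesis using IH(1)[OF fg(1,2)] by (metis le_add1 ex_in_conv)
      next
        case False
        then have "omega s f g = 0 \<or> omega s f g = 1 \<or> omega s g f = 1"
          using cambrian_omega_le[OF w fg(1,3) False] omega_antisym[of s f g] by linarith
        then show ?thesis
        proof (elim disjE)
          assume 0: "omega s f g = 0"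
          note S = square[OF w fg(1,3,2,4) False 0]
          have g: "g \<in> rotate_at s f F" and f: "f \<in> rotate_at s g F" 
            using S(1,2) fg False image_eqI[of g "slide s f" g "F - {f}"] image_eqI[of f "slide s g" f "F - {g}"]
            by (simp_all add: rotate_at_def)
          obtain m where m: "m \<in> chain_lengths s (rotate_at s g (rotate_at s f F))" using nonempty[OF g fg(4) fg(1,2)] by blast
          show ?thesis using chain_lengths_SucI[OF g fg(4) m] chain_lengths_SucI[OF f fg(2) m[unfolded S(3)]]
            by (intro exI[of _ "Suc m"]) simp
        next
          assume "omega s f g = 1"
          then show ?thesis using pent[OF fg False] by fastforce
        next
          assume "omega s g f = 1"
          then show ?thesis using pent[OF fg(3,4,1,2) False[symmetric]] by fastforce
        qed
      qed
    qed
    have "c \<in> chain_lengths s F" if ab: "a \<in> chain_lengths s F" "b \<in> chain_lengths s F" and c: "a \<le> c" "c \<le> b" for a b c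
    proof -
      obtain f a' where f: "f \<in> F" "ascending f" "a = Suc a'" "a' \<in> chain_lengths s (rotate_at s f F)" using chain_lengths_cases[OF ab(1) False] .
      obtain g b' where g: "g \<in> F" "ascending g" "b = Suc b'" "b' \<in> chain_lengths s (rotate_at s g F)" using chain_lengths_cases[OF ab(2) False] .
      obtain c' where c': "c = Suc c'" "a' \<le> c'" "c' \<le> b'" using c f(3) g(3) by (cases c) auto
      obtain m1 m2 where m: "m1 \<in> chain_lengths s (rotate_at s f F)" "m2 \<in> chain_lengths s (rotate_at s g F)" "m1 \<le> m2 + 1" "m2 \<le> m1 + 1"
        using near[OF f(1,2) g(1,2)] by blast
      show ?thesis
      \<comment> \<open>Up to \<open>m1\<close> the completions after \<open>f\<close> serve. Beyond
        it \<open>m2 \<le> m1 + 1 \<le> c'\<close>, and those after \<open>g\<close> take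
        over.\<close>
      proof (cases "c' \<le> m1")
        case True
        then show ?thesis using IH(2)[OF f(1,2) f(4) m(1)] c' chain_lengths_SucI[OF f(1,2)] by blast
      next
        case False
        then show ?thesis using IH(2)[OF g(1,2) m(2) g(4)] c' m(4) chain_lengths_SucI[OF g(1,2)] by simp
      qed
    qed
    then show ?thesis using ne by blast
  qed
qed

subsection \<open>A shortest and a longest chain\<close>

definition start_tree :: "nat \<Rightarrow> edge set" where
  "start_tree n = (\<lambda>i. (int i, int i + 1)) ` {..<n}"

lemma start_tree_iff: "(a,b) \<in> start_tree n \<longleftrightarrow> 0 \<le> a \<and> a < int n \<and> b = a + 1"
  unfolding start_tree_def by (auto simp: image_iff intro!: bexI[of _ "nat a"])

lemma start_tree_rtrancl: "(a,b) \<in> (start_tree n)\<^sup>* \<Longrightarrow> a \<le> b"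
  by (induction rule: rtrancl_induct) (auto simp: start_tree_iff)

text \<open>Here vertex signs become the orientation of the quiver: a positive \<open>k\<close>
  means an arrow from \<open>k - 1\<close> to \<open>k\<close>.\<close>

lemma omega_start_tree:
  "omega s (i,i+1) (k,k+1) = (if i = k - 1 then (if s k then 1 else -1) else if i = k + 1 then (if s i then -1 else 1) else 0)"
proof -
  consider "i = k - 1" | "i = k + 1" | "i = k" | "i < k - 1" | "i > k + 1" by linarith
  then show ?thesis
  proof cases
    case 1
    then show ?thesis using omega_head_tail[of "k-1" k "k+1" s] by (simp add: cyclic_def)
  next
    case 2
    then show ?thesis using omega_tail_head[of k "k+1" "k+2" s] by (simp add: cyclic_def algebra_simps)
  next
    case 4
    then show ?thesis using omega_disjoint[of i k "k+1" "i+1" s] by (simp add: cyclic_less)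
  next
    case 5
    then show ?thesis using omega_disjoint[of i k "k+1" "i+1" s] by (simp add: cyclic_less)
  qed (simp add: omega_refl)
qed

lemma compat_start_tree: "i \<noteq> k \<Longrightarrow> compat s (i,i+1) (k,k+1)"
  unfolding compat_def omega_start_tree by (auto simp: sym_form_def ascending_def)

lemma cambrian_start_tree: "cambrian s (start_tree n)"
proof -
  have "compat s e f" if ef: "e \<in> start_tree n" "f \<in> start_tree n" "e \<noteq> f" for e f
  proof -
    obtain i k where "e = (i,i+1)" "f = (k,k+1)" using ef(1,2) by (auto simp: start_tree_def)
    then show ?thesis using compat_start_tree[of i k s] ef(3) by auto
  qed
  moreover have "forest (start_tree n)"
    unfolding forest_def
  proof
    fix e assume "e \<in> start_tree n"
    then obtain i where e: "e = (i,i+1)" by (auto simp: start_tree_def)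
    show "\<exists>h::int \<Rightarrow> int. \<forall>g\<in>start_tree n. h (fst g) - h (snd g) = of_bool (e = g)"
      by (intro exI[of _ "\<lambda>u. of_bool (u \<le> i)"]) (auto simp: start_tree_def e)
  qed
  moreover have "in_sided s (start_tree n)"
    by (rule in_sidedI) (use start_tree_rtrancl in \<open>force simp: start_tree_iff\<close>)
  moreover have "out_sided s (start_tree n)"
    by (rule out_sidedI) (use start_tree_rtrancl in \<open>force simp: start_tree_iff\<close>)
  ultimately show ?thesis by (auto simp: cambrian_def start_tree_def)
qed

lemma verts_start_tree: "verts n (start_tree n)"
  by (auto simp: verts_def start_tree_def)

text \<open>A height function on a linearly arranged quiver: with \<open>d i\<close> the direction
  of the arrow between \<open>i\<close> and \<open>i + 1\<close>, every arrow climbs by one.\<close>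

fun level :: "(nat \<Rightarrow> int) \<Rightarrow> nat \<Rightarrow> int" where
  "level d 0 = 0"
| "level d (Suc i) = level d i + d i"

text \<open>The edges in \<open>D\<close> are reversed; if \<open>D\<close> is closed under predecessors in the quiver, rotating a source outside \<open>D\<close> slides nothing.\<close>

definition half_reversed :: "nat \<Rightarrow> nat set \<Rightarrow> edge set" where
  "half_reversed n D = (\<lambda>i. if i \<in> D then (int i + 1, int i) else (int i, int i + 1)) ` {..<n}"

lemma rotate_at_half_reversed:
  assumes k: "k < n" "k \<notin> D"
    and pred: "\<And>i. i < n \<Longrightarrow> i \<noteq> k \<Longrightarrow> omega s (int i, int i + 1) (int k, int k + 1) > 0 \<Longrightarrow> i \<in> D"
    and succ: "\<And>i. i < n \<Longrightarrow> i \<noteq> k \<Longrightarrow> omega s (int i, int i + 1) (int k, int k + 1) < 0 \<Longrightarrow> i \<notin> D"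
  shows "rotate_at s (int k, int k + 1) (half_reversed n D) = half_reversed n (insert k D)"
proof -
  define E where "E D i = (if i \<in> D then (int i + 1, int i) else (int i, int i + 1))" for D :: "nat set" and i
  have inj: "E D i = E D k \<longleftrightarrow> i = k" for i using k by (auto simp: E_def split: if_splits)
  have fixed: "slide s (int k, int k + 1) (E D i) = E (insert k D) i" if "i < n" "i \<noteq> k" for i
  proof -
    have "i \<notin> D \<Longrightarrow> \<not> omega s (int i, int i + 1) (int k, int k + 1) > 0"
      and "i \<in> D \<Longrightarrow> \<not> omega s (int i, int i + 1) (int k, int k + 1) < 0"
      using pred[OF that] succ[OF that] by blast+
    then have "omega s (E D i) (int k, int k + 1) \<le> 0"
      using omega_rev1[of s "int i + 1" "int i" "(int k, int k + 1)"] by (cases "i \<in> D") (simp_all add: E_def)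
    then show ?thesis using that by (simp add: slide_fixed E_def)
  qed
  have h: "half_reversed n D = E D ` {..<n}" for D by (simp add: half_reversed_def E_def)
  have Ek: "E D k = (int k, int k + 1)" using k by (simp add: E_def)
  have "half_reversed n D - {(int k, int k + 1)} = E D ` ({..<n} - {k})"
    unfolding h Ek[symmetric] by (auto simp: inj eq_commute[of "E D k"])
  moreover have "slide s (int k, int k + 1) ` E D ` ({..<n} - {k}) = E (insert k D) ` ({..<n} - {k})"
    unfolding image_image by (intro image_cong refl fixed) auto
  ultimately have "rotate_at s (int k, int k + 1) (half_reversed n D) = insert (int k + 1, int k) (E (insert k D) ` ({..<n} - {k}))"
    unfolding rotate_at_def by simp
  also have "(int k + 1, int k) = E (insert k D) k" by (simp add: E_def)
  also have "insert (E (insert k D) k) (E (insert k D) ` ({..<n} - {k})) = E (insert k D) ` insert k ({..<n} - {k})"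
    by (rule image_insert[symmetric])
  also have "insert k ({..<n} - {k}) = {..<n}" using k by auto
  finally show ?thesis unfolding h .
qed

text \<open>Edges are reversed in order of increasing level. Arrows climb, so the hypothesis on
  \<open>D\<close> makes it closed under predecessors.\<close>

lemma half_reversed_chain_lengths:
  fixes s :: "int \<Rightarrow> bool"
  defines "lev \<equiv> level (\<lambda>i. if s (int i + 1) then 1 else -1)"
  assumes D: "D \<subseteq> {..<n}" "\<And>i j. i < n \<Longrightarrow> i \<notin> D \<Longrightarrow> j \<in> D \<Longrightarrow> lev j \<le> lev i"
  shows "n - card D \<in> chain_lengths s (half_reversed n D)"
  using D
proof (induction "n - card D" arbitrary: D)
  case 0
  then have "D = {..<n}" using card_subset_eq[of "{..<n}" D] card_mono[of "{..<n}" D] by simp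
  then have "terminal (half_reversed n D)" by (auto simp: terminal_def half_reversed_def ascending_def)
  then show ?case using 0 by (simp add: chain_lengths_terminal)
next
  case (Suc m)
  have fin: "finite D" using Suc.prems(1) finite_subset by blast
  have "{..<n} - D \<noteq> {}" using Suc by (metis Diff_eq_empty_iff card_lessThan card_mono diff_is_0_eq fin nat.distinct(1))
  \<comment> \<open>A lowest remaining vertex: its predecessors are all in \<open>D\<close>, its
    successors are all outside.\<close>
  then obtain k where "is_arg_min lev (\<lambda>i. i \<in> {..<n} - D) k"
    using ex_is_arg_min_if_finite[of "{..<n} - D" lev] by auto
  then have k: "k \<in> {..<n} - D" and kmin: "\<And>i. i \<in> {..<n} - D \<Longrightarrow> lev k \<le> lev i"
    by (auto simp: is_arg_min_linorder)
  have levS: "lev (Suc i) = lev i + (if s (int i + 1) then 1 else -1)" for i by (simp add: lev_def)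
  have lo: "lev i < lev k" if "i \<noteq> k" "omega s (int i, int i + 1) (int k, int k + 1) > 0" for i
  proof -
    have "k = Suc i \<and> s (int k) \<or> i = Suc k \<and> \<not> s (int i)" using that(2) unfolding omega_start_tree by (auto split: if_splits)
    then show ?thesis using levS[of i] levS[of k] by (auto simp: add.commute)
  qed
  have hi: "lev i > lev k" if "i \<noteq> k" "omega s (int i, int i + 1) (int k, int k + 1) < 0" for i
  proof -
    have "k = Suc i \<and> \<not> s (int k) \<or> i = Suc k \<and> s (int i)" using that(2) unfolding omega_start_tree by (auto split: if_splits)
    then show ?thesis using levS[of i] levS[of k] by (auto simp: add.commute)
  qed
  have "rotate_at s (int k, int k + 1) (half_reversed n D) = half_reversed n (insert k D)"
  proof (rule rotate_at_half_reversed)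
    show "i \<in> D" if "i < n" "i \<noteq> k" "omega s (int i, int i + 1) (int k, int k + 1) > 0" for i
      using lo[OF that(2,3)] kmin[of i] that(1) by force
    show "i \<notin> D" if "i < n" "i \<noteq> k" "omega s (int i, int i + 1) (int k, int k + 1) < 0" for i
      using hi[OF that(2,3)] Suc.prems(2)[of k i] k by force
  qed (use k in auto)
  moreover have "m \<in> chain_lengths s (half_reversed n (insert k D))"
  proof -
    have m: "m = n - card (insert k D)" using Suc.hyps(2) k fin by simp
    show ?thesis unfolding m
    proof (rule Suc.hyps(1)[OF m])
      show "insert k D \<subseteq> {..<n}" using k Suc.prems(1) by auto
      show "lev j \<le> lev i" if "i < n" "i \<notin> insert k D" "j \<in> insert k D" for i j
        using that kmin[of i] Suc.prems(2)[of i j] by auto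
    qed
  qed
  moreover have "(int k, int k + 1) \<in> half_reversed n D" using k by (auto simp: half_reversed_def)
  ultimately show ?case unfolding Suc.hyps(2)[symmetric]
    by (intro chain_lengths_SucI[of "(int k, int k + 1)"]) (auto simp: ascending_def)
qed

lemma start_tree_lens_min: "n \<in> chain_lengths s (start_tree n)"
  using half_reversed_chain_lengths[of "{}" n s] by (simp add: half_reversed_def start_tree_def)

section \<open>The longest chain: paths and adjacent transpositions\<close>

definition path_edges :: "nat \<Rightarrow> (nat \<Rightarrow> int) \<Rightarrow> edge set" where
  "path_edges n w = (\<lambda>i. (w i, w (Suc i))) ` {..<n}"

definition swap_at :: "nat \<Rightarrow> nat \<Rightarrow> nat" where
  "swap_at k i = (if i = k then Suc k else if i = Suc k then k else i)"

definition perm_inv :: "nat \<Rightarrow> (nat \<Rightarrow> int) \<Rightarrow> (nat \<times> nat) set" where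
  "perm_inv n w = {(i,j). i < j \<and> j \<le> n \<and> w j < w i}"

lemma finite_perm_inv: "finite (perm_inv n w)"
  by (rule finite_subset[of _ "{..n} \<times> {..n}"]) (auto simp: perm_inv_def)

text \<open>The transposition of positions preserves the order of every pair but
  \<open>(k, Suc k)\<close>, so it maps the old inversions bijectively to the new ones other than
  that pair.\<close>

lemma perm_inv_swap:
  assumes "k < n" "w k < w (Suc k)"
  shows "card (perm_inv n (w \<circ> swap_at k)) = Suc (card (perm_inv n w))"
proof -
  have ss: "swap_at k (swap_at k i) = i" for i by (auto simp: swap_at_def)
  have mono: "swap_at k i < swap_at k j" if "i < j" "(i,j) \<noteq> (k, Suc k)" for i j
    using that by (auto simp: swap_at_def)
  have le: "swap_at k j \<le> n" if "j \<le> n" for j using that assms(1) by (auto simp: swap_at_def)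
  let ?t = "map_prod (swap_at k) (swap_at k)"
  have eq: "perm_inv n (w \<circ> swap_at k) = insert (k, Suc k) (?t ` perm_inv n w)" (is "?L = ?R")
  proof
    show "?L \<subseteq> ?R"
    proof clarify
      fix i j assume ij: "(i,j) \<in> ?L" "(i,j) \<notin> ?t ` perm_inv n w"
      show "i = k \<and> j = Suc k"
      proof (rule ccontr)
        assume ne: "\<not> (i = k \<and> j = Suc k)"
        then have "(swap_at k i, swap_at k j) \<in> perm_inv n w"
          using ij(1) mono[of i j] le[of j] by (auto simp: perm_inv_def)
        then have "?t (swap_at k i, swap_at k j) \<in> ?t ` perm_inv n w" by (rule imageI)
        then show False using ij(2) by (simp add: ss)
      qed
    qed
    show "?R \<subseteq> ?L"
    proof -
      have "(swap_at k i, swap_at k j) \<in> ?L" if "(i,j) \<in> perm_inv n w" for i j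
      proof -
        have "(i,j) \<noteq> (k, Suc k)" using that assms(2) by (auto simp: perm_inv_def)
        then show ?thesis using that mono[of i j] le[of j] by (auto simp: perm_inv_def ss)
      qed
      moreover have "(k, Suc k) \<in> ?L" using assms by (auto simp: perm_inv_def swap_at_def)
      ultimately show ?thesis by auto
    qed
  qed
  have "(k, Suc k) \<notin> ?t ` perm_inv n w"
  proof
    assume "(k, Suc k) \<in> ?t ` perm_inv n w"
    then obtain i j where ij: "(i,j) \<in> perm_inv n w" "swap_at k i = k" "swap_at k j = Suc k" by auto
    then have "i = Suc k" "j = k" using ss by (metis swap_at_def)+
    then show False using ij(1) by (simp add: perm_inv_def)
  qed
  moreover have "inj_on ?t (perm_inv n w)" by (rule inj_onI) (metis map_prod_simp prod.collapse prod.inject ss)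
  ultimately show ?thesis unfolding eq by (simp add: finite_perm_inv card_image)
qed

lemma perm_inv_decreasing:
  assumes "\<And>i. i < n \<Longrightarrow> w (Suc i) < w i"
  shows "card (perm_inv n w) = n * (n + 1) div 2"
proof -
  have "w j < w i" if "i < j" "j \<le> n" for i j
    using that
  proof (induction j)
    case (Suc j)
    then show ?case using assms[of j] by (cases "i = j") auto
  qed simp
  then have "perm_inv n w = (\<lambda>(a,b). (nat a, nat b)) ` {(a,b). 0 \<le> a \<and> a < b \<and> b \<le> int n}"
    by (auto simp: perm_inv_def image_iff intro!: exI[of _ "int _"]) 
  moreover have "inj_on (\<lambda>(a,b). (nat a, nat b)) {(a,b). 0 \<le> a \<and> a < b \<and> b \<le> int n}"
    by (auto simp: inj_on_def)
  ultimately show ?thesis using card_pairs[of n] by (simp only: card_image)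
qed

text \<open>At a sink both neighbours slide and all other edges stay, so the result is again a path,
  with two consecutive vertices exchanged.\<close>

lemma path_rotate_at:
  assumes w: "cambrian s (path_edges n w)" and inj: "inj_on w {..n}" and k: "k < n" "w k < w (Suc k)"
    and left: "0 < k \<Longrightarrow> omega s (w (k - 1), w k) (w k, w (Suc k)) = 1"
    and right: "Suc k < n \<Longrightarrow> omega s (w (Suc k), w (Suc (Suc k))) (w k, w (Suc k)) = 1"
  shows "rotate_at s (w k, w (Suc k)) (path_edges n w) = path_edges n (w \<circ> swap_at k)"
proof -
  have weq: "w i = w j \<longleftrightarrow> i = j" if "i \<le> n" "j \<le> n" for i j using inj that by (auto simp: inj_on_def)
  have "slide s (w k, w (Suc k)) (w i, w (Suc i)) = (w (swap_at k i), w (swap_at k (Suc i)))" if i: "i < n" "i \<noteq> k" for i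
  proof -
    consider "Suc i = k" | "i = Suc k" | "Suc i < k \<or> i > Suc k" using i by linarith
    then show ?thesis
    proof cases
      case 1
      then show ?thesis using left by (auto simp: slide_def swap_at_def)
    next
      case 2
      then show ?thesis using right i k weq by (auto simp: slide_def swap_at_def)
    next
      case 3
      have "(w i, w (Suc i)) \<noteq> (w k, w (Suc k))" using weq i k by simp
      then have "compat s (w i, w (Suc i)) (w k, w (Suc k))"
        using cambrian_compat[OF w, of "(w i, w (Suc i))" "(w k, w (Suc k))"] i k by (simp add: path_edges_def)
      moreover have "sym_form (w i, w (Suc i)) (w k, w (Suc k)) = 0"
        proof -
        have "i \<noteq> k" "Suc i \<noteq> k" "i \<noteq> Suc k" using 3 by auto
        then show ?thesis
          using weq[of i k] weq[of "Suc i" k] weq[of i "Suc k"] weq[of "Suc i" "Suc k"] i k by (simp add: sym_form_def)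
      qed
      ultimately have "omega s (w i, w (Suc i)) (w k, w (Suc k)) = 0" by (simp add: compat_def)
      then show ?thesis using 3 i by (auto simp: slide_fixed swap_at_def)
    qed
  qed
  then have "slide s (w k, w (Suc k)) ` (\<lambda>i. (w i, w (Suc i))) ` ({..<n} - {k}) = (\<lambda>i. (w (swap_at k i), w (swap_at k (Suc i)))) ` ({..<n} - {k})"
    unfolding image_image by (intro image_cong) auto
  moreover have "path_edges n w - {(w k, w (Suc k))} = (\<lambda>i. (w i, w (Suc i))) ` ({..<n} - {k})"
  proof -
    let ?e = "\<lambda>i. (w i, w (Suc i))"
    have "inj_on ?e {..<n}" by (rule inj_onI) (use weq in simp)
    then have "?e ` {..<n} - {?e k} = ?e ` ({..<n} - {k})"
      using inj_on_image_set_diff[of ?e "{..<n}" "{..<n}" "{k}"] k by simp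
    then show ?thesis unfolding path_edges_def .
  qed
  ultimately have "rotate_at s (w k, w (Suc k)) (path_edges n w) = insert (w (Suc k), w k) ((\<lambda>i. (w (swap_at k i), w (swap_at k (Suc i)))) ` ({..<n} - {k}))"
    unfolding rotate_at_def by simp
  also have "(w (Suc k), w k) = (w (swap_at k k), w (swap_at k (Suc k)))" by (simp add: swap_at_def)
  also have "insert \<dots> ((\<lambda>i. (w (swap_at k i), w (swap_at k (Suc i)))) ` ({..<n} - {k})) = (\<lambda>i. (w (swap_at k i), w (swap_at k (Suc i)))) ` insert k ({..<n} - {k})"
    by (rule image_insert[symmetric])
  also have "insert k ({..<n} - {k}) = {..<n}" using k by auto
  finally show ?thesis by (simp add: path_edges_def)
qed

text \<open>In a path, an arrow from an ascending edge always ends in an ascending edge; so an ascending edge of maximal level is a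
sink, and rotating it transposes two consecutive vertices of the path.\<close>

lemma path_chain_lengths:
  assumes "cambrian s (path_edges n w)" "inj_on w {..n}"
  shows "\<exists>l\<in>chain_lengths s (path_edges n w). l + card (perm_inv n w) = n * (n + 1) div 2"
  using assms
proof (induction "n * (n + 1) div 2 - card (perm_inv n w)" arbitrary: w rule: less_induct)
  case less
  note wl = less.prems(1) and inj = less.prems(2)
  show ?case
  proof (cases "terminal (path_edges n w)")
    case True
    have "w (Suc i) < w i" if "i < n" for i
    proof -
      have "\<not> ascending (w i, w (Suc i))" using True that by (auto simp: terminal_def path_edges_def)
      moreover have "w i \<noteq> w (Suc i)" using inj_onD[OF inj, of i "Suc i"] that by auto
      ultimately show ?thesis by (simp add: ascending_def)
    qed
    then show ?thesis using True perm_inv_decreasing[of n w] by (simp add: chain_lengths_terminal)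
  next
    case False
    define e where "e i = (w i, w (Suc i))" for i
    define d where "d i = omega s (e i) (e (Suc i))" for i
    define G where "G = {i. i < n \<and> ascending (e i)}"
    have "finite G" "G \<noteq> {}" using False by (auto simp: G_def terminal_def path_edges_def e_def)
    \<comment> \<open>Arrows climb in level, so an ascending edge of maximal level has no arrow to
      an ascending neighbour.\<close>
    then obtain k where "is_arg_min (\<lambda>i. - level d i) (\<lambda>i. i \<in> G) k"
      using ex_is_arg_min_if_finite[of G "\<lambda>i. - level d i"] by auto
    then have k: "k \<in> G" and kmax: "\<And>i. i \<in> G \<Longrightarrow> level d i \<le> level d k"
      by (auto simp: is_arg_min_linorder)
    have kn: "k < n" "w k < w (Suc k)" using k by (auto simp: G_def e_def ascending_def)
    have weq: "w i = w j \<longleftrightarrow> i = j" if "i \<le> n" "j \<le> n" for i j using inj that by (auto simp: inj_on_def)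
    have adj: "compat s (e i) (e (Suc i))" "sym_form (e i) (e (Suc i)) = -1" if "Suc i < n" for i
    proof -
      show "compat s (e i) (e (Suc i))"
        using cambrian_compat[OF wl, of "e i" "e (Suc i)"] that weq[of i "Suc i"] by (auto simp: path_edges_def e_def)
      show "sym_form (e i) (e (Suc i)) = -1"
        using that weq[of i "Suc i"] weq[of i "Suc (Suc i)"] weq[of "Suc i" "Suc (Suc i)"] by (simp add: sym_form_def e_def)
    qed
    have left: "omega s (w (k - 1), w k) (w k, w (Suc k)) = 1" if k0: "0 < k"
    proof -
      obtain i where i: "k = Suc i" using gr0_implies_Suc[OF k0] by blast
      have "d i = 1"
      proof (rule ccontr)
        \<comment> \<open>Then the arrow goes from \<open>e k\<close> up to \<open>e i\<close>,
          which is descending by maximality; compatibility forbids an arrow from an ascending to a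
          descending neighbour.\<close>
        assume "d i \<noteq> 1"
        then have di: "d i = -1" using adj[of i] kn i by (auto simp: compat_def d_def)
        then have "i \<notin> G" using kmax[of i] i by auto
        then have "\<not> ascending (e i)" "ascending (e (Suc i))" using k i by (auto simp: G_def)
        then show False using adj[of i] kn i di omega_antisym[of s "e i" "e (Suc i)"] by (auto simp: compat_def d_def)
      qed
      then show ?thesis by (simp add: d_def e_def i)
    qed
    have right: "omega s (w (Suc k), w (Suc (Suc k))) (w k, w (Suc k)) = 1" if "Suc k < n"
    proof -
      have "d k = -1"
      proof (rule ccontr)
        assume "d k \<noteq> -1"
        then have dk: "d k = 1" using adj[OF that] by (auto simp: compat_def d_def)
        then have "Suc k \<notin> G" using kmax[of "Suc k"] by auto
        then have "\<not> ascending (e (Suc k))" "ascending (e k)" using k that by (auto simp: G_def)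
        then show False using adj[OF that] dk by (auto simp: compat_def d_def)
      qed
      then show ?thesis using omega_antisym[of s "e k" "e (Suc k)"] by (simp add: d_def e_def)
    qed
    let ?w = "w \<circ> swap_at k"
    have rotate_at: "rotate_at s (e k) (path_edges n w) = path_edges n ?w"
      unfolding e_def by (rule path_rotate_at[OF wl inj kn left right])
    have ek: "e k \<in> path_edges n w" "ascending (e k)" using k by (auto simp: G_def path_edges_def e_def)
    have wl': "cambrian s (path_edges n ?w)" using cambrian_rotate_at[OF wl ek] rotate_at by simp
    have inj': "inj_on ?w {..n}"
      by (rule comp_inj_on) (use inj kn in \<open>auto simp: inj_on_def swap_at_def\<close>)
    have c: "card (perm_inv n ?w) = Suc (card (perm_inv n w))" by (rule perm_inv_swap[of k n w, OF kn])
    \<comment> \<open>The decreasing word \<open>\<lambda>i. - int i\<close> inverts all pairs,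
      which bounds the inversions of any word.\<close>
    have "perm_inv n w \<subseteq> perm_inv n (\<lambda>i. - int i)" by (auto simp: perm_inv_def)
    then have "card (perm_inv n w) \<le> n * (n + 1) div 2" for w :: "nat \<Rightarrow> int"
      using card_mono[OF finite_perm_inv, of "perm_inv n w" n "\<lambda>i. - int i"] perm_inv_decreasing[of n "\<lambda>i. - int i"]
      by (auto simp: perm_inv_def)
    from this[of ?w] have "n * (n + 1) div 2 - card (perm_inv n ?w) < n * (n + 1) div 2 - card (perm_inv n w)" using c by linarith
    from less.hyps[OF this wl' inj'] obtain l where l: "l \<in> chain_lengths s (path_edges n ?w)" "l + card (perm_inv n ?w) = n * (n + 1) div 2" by blast
    have "Suc l \<in> chain_lengths s (path_edges n w)" using chain_lengths_SucI[OF ek] l(1) rotate_at by simp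
    moreover have "Suc l + card (perm_inv n w) = n * (n + 1) div 2" using l(2) c by simp
    ultimately show ?thesis by blast
  qed
qed

lemma start_tree_lens_max: "n * (n + 1) div 2 \<in> chain_lengths s (start_tree n)"
proof -
  have b: "path_edges n int = start_tree n" by (auto simp: path_edges_def start_tree_def)
  have "perm_inv n int = {}" by (auto simp: perm_inv_def)
  then show ?thesis using path_chain_lengths[of s n int] cambrian_start_tree[of s n] by (auto simp: b)
qed

subsection \<open>Framed quivers\<close>

text \<open>The signed indicator of the interval of simple roots between the ends of the
  edge.\<close>

definition cvec :: "edge \<Rightarrow> nat \<Rightarrow> int" where
  "cvec e v = of_bool (fst e \<le> int v) - of_bool (snd e \<le> int v)"

text \<open>The forms hold net numbers of arrows; \<open>nat\<close> splits them into two
  multiplicities, at most one of which is positive.\<close>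

definition represents :: "nat \<Rightarrow> (int \<Rightarrow> bool) \<Rightarrow> (nat \<Rightarrow> edge) \<Rightarrow> (nat + nat) quiver \<Rightarrow> bool" where
  "represents n s e R \<longleftrightarrow>
     (\<forall>i<n. \<forall>j<n. R (Inl i) (Inl j) = nat (omega s (e i) (e j))) \<and>
     (\<forall>i<n. \<forall>v. R (Inl i) (Inr v) = nat (cvec (e i) v) \<and> R (Inr v) (Inl i) = nat (- cvec (e i) v))"

definition mut_edges :: "(int \<Rightarrow> bool) \<Rightarrow> nat \<Rightarrow> (nat \<Rightarrow> edge) \<Rightarrow> nat \<Rightarrow> edge" where
  "mut_edges s k e i = (if i = k then rev_edge (e k) else slide s (e k) (e i))"

definition labelled :: "nat \<Rightarrow> (int \<Rightarrow> bool) \<Rightarrow> (nat \<Rightarrow> edge) \<Rightarrow> bool" where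
  "labelled n s e \<longleftrightarrow> cambrian s (e ` {..<n}) \<and> verts n (e ` {..<n}) \<and> inj_on e {..<n}"

lemma diff_min: "a - min a b = nat (int a - int b)"
  by auto

text \<open>Cancelling 2-cycles is truncated subtraction, hence \<open>nat\<close> of an integer
  difference.\<close>

lemma mutate_apply:
  "mutate fr k R x y = (if fr x \<and> fr y then 0
     else if x = y then (if x = k then R x x else R x x + R x k * R k x)
     else if x = k \<or> y = k then nat (int (R y x) - int (R x y))
     else nat (int (R x y + R x k * R k y) - int (R y x + R y k * R k x)))"
  by (auto simp: mutate_def Let_def diff_min)

lemma green_iff:
  assumes "represents n s e R" "labelled n s e" "i < n"
  shows "green R i \<longleftrightarrow> ascending (e i)"
proof -
  have "e i \<in> e ` {..<n}" using assms(3) by simp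
  then have 0: "0 \<le> snd (e i)" and ne: "fst (e i) \<noteq> snd (e i)"
    using assms(2) by (auto simp: labelled_def verts_def cambrian_def)
  have "green R i \<longleftrightarrow> (\<forall>v. cvec (e i) v \<ge> 0)"
    using assms(1,3) by (auto simp: green_def represents_def)
  also have "\<dots> \<longleftrightarrow> fst (e i) < snd (e i)"
  proof
    assume "\<forall>v. cvec (e i) v \<ge> 0"
    \<comment> \<open>For a descending edge the head is the smaller end, and the c-vector is -1
      there.\<close>
    then have "cvec (e i) (nat (snd (e i))) \<ge> 0" by blast
    then show "fst (e i) < snd (e i)" using 0 ne by (simp add: cvec_def split: if_splits)
  qed (auto simp: cvec_def)
  finally show ?thesis by (simp add: ascending_def)
qed

lemma labelled_mut:
  assumes l: "labelled n s e" and k: "k < n" "ascending (e k)"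
  shows "mut_edges s k e ` {..<n} = rotate_at s (e k) (e ` {..<n})" "labelled n s (mut_edges s k e)"
proof -
  let ?F = "e ` {..<n}"
  have w: "cambrian s ?F" and v: "verts n ?F" and inj: "inj_on e {..<n}" using l by (auto simp: labelled_def)
  have ek: "e k \<in> ?F" using k by simp
  have "?F - {e k} = e ` ({..<n} - {k})" using inj_on_image_set_diff[OF inj, of "{..<n}" "{k}"] k by simp
  then have "rotate_at s (e k) ?F = insert (rev_edge (e k)) ((\<lambda>i. slide s (e k) (e i)) ` ({..<n} - {k}))"
    by (simp add: rotate_at_def rev_edge_def image_image)
  also have "\<dots> = insert (mut_edges s k e k) (mut_edges s k e ` ({..<n} - {k}))" by (simp add: mut_edges_def)
  also have "\<dots> = mut_edges s k e ` insert k ({..<n} - {k})" by (rule image_insert[symmetric])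
  also have "insert k ({..<n} - {k}) = {..<n}" using k by auto
  finally show eq: "mut_edges s k e ` {..<n} = rotate_at s (e k) (e ` {..<n})" by simp
  have "inj_on (mut_edges s k e) {..<n}"
  proof (rule inj_onI)
    have neq: "mut_edges s k e i \<noteq> mut_edges s k e j" if "i < n" "j < n" "i \<noteq> j" "i \<noteq> k" for i j
    proof -
      have ne: "e i \<noteq> e k" "e i \<noteq> e j" "j \<noteq> k \<Longrightarrow> e j \<noteq> e k" using inj_onD[OF inj] that k by auto
      have F: "?F = insert (e k) (insert (e i) (?F - {e k, e i}))" using that k by auto
      show ?thesis
        using slide_notin[OF w F _ _ ne(1)[symmetric] k(2)] that ne by (auto simp: mut_edges_def)
    qed
    show "i = j" if "i \<in> {..<n}" "j \<in> {..<n}" "mut_edges s k e i = mut_edges s k e j" for i j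
      using neq[of i j] neq[of j i] that by fastforce
  qed
  then show "labelled n s (mut_edges s k e)"
    using eq cambrian_rotate_at[OF w ek k(2)] verts_rotate_at[OF v ek] by (simp add: labelled_def)
qed

lemma cvec_slide:
  assumes "cambrian s F" "e \<in> F" "f \<in> F" "e \<noteq> f" "ascending f"
  shows "cvec (slide s f e) v = cvec e v + (if omega s e f > 0 then cvec f v else 0)"
  using cambrian_slid[OF assms] by (auto simp: cvec_def slide_def)

text \<open>Matrix mutation is bilinearity of \<open>omega\<close> applied to slid edges. For frozen
  vertices, \<open>e k\<close> ascends, so only paths from \<open>i\<close> through \<open>k\<close>
  to a frozen vertex contribute.\<close>

lemma represents_mutate:
  assumes r: "represents n s e R" and l: "labelled n s e" and k: "k < n" "ascending (e k)"
  shows "represents n s (mut_edges s k e) (mutate frozen (Inl k) R)"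
proof -
  let ?F = "e ` {..<n}"
  have w: "cambrian s ?F" and inj: "inj_on e {..<n}" using l by (auto simp: labelled_def)
  have R: "R (Inl i) (Inl j) = nat (omega s (e i) (e j))" if "i < n" "j < n" for i j
    using r that by (simp add: represents_def)
  have C: "R (Inl i) (Inr v) = nat (cvec (e i) v)" "R (Inr v) (Inl i) = nat (- cvec (e i) v)" if "i < n" for i v
    using r that by (simp_all add: represents_def)
  have ck: "cvec (e k) v = 0 \<or> cvec (e k) v = 1" for v using k(2) by (auto simp: cvec_def ascending_def)
  have small: "omega s (e i) (e k) = -1 \<or> omega s (e i) (e k) = 0 \<or> omega s (e i) (e k) = 1" if "i < n" for i
  proof (cases "e i = e k")
    case False
    then show ?thesis using cambrian_omega_le[OF w, of "e i" "e k"] that k(1) by auto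
  qed (simp add: omega_refl)
  have osl: "omega s (slide s (e k) (e i)) g = omega s (e i) g + (if omega s (e i) (e k) > 0 then omega s (e k) g else 0)"
    and csl: "cvec (slide s (e k) (e i)) v = cvec (e i) v + (if omega s (e i) (e k) > 0 then cvec (e k) v else 0)"
    if "i < n" "i \<noteq> k" for i g v
  proof -
    have "e i \<noteq> e k" using inj_onD[OF inj, of i k] that k(1) by auto
    then show "omega s (slide s (e k) (e i)) g = omega s (e i) g + (if omega s (e i) (e k) > 0 then omega s (e k) g else 0)"
      and "cvec (slide s (e k) (e i)) v = cvec (e i) v + (if omega s (e i) (e k) > 0 then cvec (e k) v else 0)"
      using omega_slide[OF w, of "e i" "e k" g] cvec_slide[OF w, of "e i" "e k" v] that k by simp_all
  qed
  have osl2: "omega s g (slide s (e k) (e i)) = omega s g (e i) + (if omega s (e i) (e k) > 0 then omega s g (e k) else 0)"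
    if "i < n" "i \<noteq> k" for i g
    using osl[OF that, of g] omega_antisym[of s g] by simp
  have "mutate frozen (Inl k) R (Inl i) (Inl j) = nat (omega s (mut_edges s k e i) (mut_edges s k e j))"
    if ij: "i < n" "j < n" for i j
  proof -
    consider "i = k" "j = k" | "i = k" "j \<noteq> k" | "i \<noteq> k" "j = k" | "i = j" "i \<noteq> k" | "i \<noteq> j" "i \<noteq> k" "j \<noteq> k" by blast
    then show ?thesis
    proof cases
      case 1
      then show ?thesis using k R by (simp add: mutate_apply frozen_def omega_refl)
    next
      case 2
      then show ?thesis using ij k R osl2[of j "e k"] omega_rev(1)[of s "e k"] omega_antisym[of s "e k" "e j"] omega_refl[of s "e k"]
        by (simp add: mutate_apply frozen_def mut_edges_def)
    next
      case 3
      then show ?thesis using ij k R osl[of i "e k"] omega_rev(2)[of s _ "e k"] omega_antisym[of s "e k" "e i"] omega_refl[of s "e k"]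
        by (simp add: mutate_apply frozen_def mut_edges_def)
    next
      case 4
      then show ?thesis using ij k R small[of i] omega_antisym[of s "e k" "e i"]
        by (auto simp: mutate_apply frozen_def omega_refl)
    next
      case 5
      \<comment> \<open>The mutation rule in the form where one factor of each product keeps its
        sign. Entries in column \<open>k\<close> are -1, 0 or 1, so it is compared case by case with
        the rule for arrow counts.\<close>
      have "omega s (mut_edges s k e i) (mut_edges s k e j) = omega s (e i) (e j)
          + (if omega s (e i) (e k) > 0 then omega s (e k) (e j) else 0) + (if omega s (e j) (e k) > 0 then omega s (e i) (e k) else 0)"
        using 5 ij osl[of i] osl2[of j] omega_refl[of s "e k"] by (simp add: mut_edges_def)
      moreover have "mutate frozen (Inl k) R (Inl i) (Inl j) = nat (int (nat (omega s (e i) (e j)) + nat (omega s (e i) (e k)) * nat (omega s (e k) (e j)))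
          - int (nat (omega s (e j) (e i)) + nat (omega s (e j) (e k)) * nat (omega s (e k) (e i))))"
        using 5 ij k R by (simp add: mutate_apply frozen_def)
      ultimately show ?thesis
        using small[OF ij(1)] small[OF ij(2)] omega_antisym[of s "e k" "e i"] omega_antisym[of s "e k" "e j"] omega_antisym[of s "e i" "e j"]
        by (elim disjE) simp_all
    qed
  qed
  moreover have "mutate frozen (Inl k) R (Inl i) (Inr v) = nat (cvec (mut_edges s k e i) v) \<and>
      mutate frozen (Inl k) R (Inr v) (Inl i) = nat (- cvec (mut_edges s k e i) v)" if i: "i < n" for i v
  proof (cases "i = k")
    case True
    have "cvec (rev_edge (e k)) v = - cvec (e k) v" by (simp add: cvec_def rev_edge_def)
    then show ?thesis using True C[OF k(1)] by (simp add: mutate_apply frozen_def mut_edges_def)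
  next
    case False
    have "cvec (mut_edges s k e i) v = cvec (e i) v + (if omega s (e i) (e k) > 0 then cvec (e k) v else 0)"
      using csl[OF i False] False by (simp add: mut_edges_def)
    moreover have "mutate frozen (Inl k) R (Inl i) (Inr v) = nat (int (R (Inl i) (Inr v) + R (Inl i) (Inl k) * R (Inl k) (Inr v))
          - int (R (Inr v) (Inl i) + R (Inr v) (Inl k) * R (Inl k) (Inl i)))"
        "mutate frozen (Inl k) R (Inr v) (Inl i) = nat (int (R (Inr v) (Inl i) + R (Inr v) (Inl k) * R (Inl k) (Inl i))
          - int (R (Inl i) (Inr v) + R (Inl i) (Inl k) * R (Inl k) (Inr v)))"
      using False by (simp_all add: mutate_apply frozen_def)
    moreover have "int (R (Inl i) (Inr v) + R (Inl i) (Inl k) * R (Inl k) (Inr v)) - int (R (Inr v) (Inl i) + R (Inr v) (Inl k) * R (Inl k) (Inl i))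
       = cvec (e i) v + (if omega s (e i) (e k) > 0 then cvec (e k) v else 0)"
      using ck[of v] small[OF i] unfolding C[OF i] C[OF k(1)] R[OF i k(1)] by (elim disjE) simp_all
    ultimately show ?thesis by (simp del: of_nat_add of_nat_mult)
  qed
  ultimately show ?thesis by (simp add: represents_def)
qed

section \<open>Green sequences as chains, and vertices that are never mutated\<close>

lemma mutate_seq_simps [simp]: "mutate_seq R [] = R" "mutate_seq R (i # sq) = mutate_seq (mutate frozen (Inl i) R) sq"
  by (simp_all add: mutate_seq_def)

lemma green_chain_lengths:
  assumes "represents n s e R" "labelled n s e"
  shows "(\<exists>sq. green_from n R sq \<and> length sq = l \<and> (\<forall>i<n. \<not> green (mutate_seq R sq) i)) \<longleftrightarrow> l \<in> chain_lengths s (e ` {..<n})"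
    (is "?P l R \<longleftrightarrow> _")
  using assms
proof (induction l arbitrary: e R)
  case 0
  have "?P 0 R \<longleftrightarrow> terminal (e ` {..<n})"
    using green_iff[OF 0] by (auto simp: terminal_def)
  also have "\<dots> \<longleftrightarrow> 0 \<in> chain_lengths s (e ` {..<n})" by (simp add: chain_lengths_def)
  finally show ?case .
next
  case (Suc l)
  note r = Suc.prems(1) and la = Suc.prems(2)
  have IH: "?P l (mutate frozen (Inl k) R) \<longleftrightarrow> l \<in> chain_lengths s (rotate_at s (e k) (e ` {..<n}))" if "k < n" "ascending (e k)" for k
    using Suc.IH[OF represents_mutate[OF r la that] labelled_mut(2)[OF la that]] labelled_mut(1)[OF la that] by simp
  have "?P (Suc l) R \<longleftrightarrow> (\<exists>k<n. green R k \<and> ?P l (mutate frozen (Inl k) R))"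
  proof
    assume "?P (Suc l) R"
    then obtain sq where sq: "green_from n R sq" "length sq = Suc l" "\<forall>i<n. \<not> green (mutate_seq R sq) i" by blast
    then obtain k sq' where "sq = k # sq'" by (cases sq) auto
    then show "\<exists>k<n. green R k \<and> ?P l (mutate frozen (Inl k) R)" using sq by (intro exI[of _ k]) auto
  next
    assume "\<exists>k<n. green R k \<and> ?P l (mutate frozen (Inl k) R)"
    then obtain k sq where "k < n" "green R k" "green_from n (mutate frozen (Inl k) R) sq" "length sq = l"
      "\<forall>i<n. \<not> green (mutate_seq (mutate frozen (Inl k) R) sq) i" by blast
    then show "?P (Suc l) R" by (intro exI[of _ "k # sq"]) simp
  qed
  also have "\<dots> \<longleftrightarrow> (\<exists>k<n. ascending (e k) \<and> l \<in> chain_lengths s (rotate_at s (e k) (e ` {..<n})))"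
    by (simp add: IH green_iff[OF r la] cong: conj_cong)
  also have "\<dots> \<longleftrightarrow> Suc l \<in> chain_lengths s (e ` {..<n})"
  proof
    assume "\<exists>k<n. ascending (e k) \<and> l \<in> chain_lengths s (rotate_at s (e k) (e ` {..<n}))"
    then obtain k where "k < n" "ascending (e k)" "l \<in> chain_lengths s (rotate_at s (e k) (e ` {..<n}))" by blast
    then show "Suc l \<in> chain_lengths s (e ` {..<n})" using chain_lengths_SucI[of "e k" "e ` {..<n}" l s] by simp
  next
    assume S: "Suc l \<in> chain_lengths s (e ` {..<n})"
    then have "\<not> terminal (e ` {..<n})" using chain_lengths_terminal by force
    from chain_lengths_cases[OF S this] show "\<exists>k<n. ascending (e k) \<and> l \<in> chain_lengths s (rotate_at s (e k) (e ` {..<n}))" by blast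
  qed
  finally show ?case .
qed

text \<open>Since \<open>k\<close> is green, no path from a frozen vertex passes through
  \<open>k\<close>, so no arrow from a frozen vertex to \<open>i\<close> arises.\<close>

lemma green_mutate:
  assumes "green R i" "green R k" "i \<noteq> k" shows "green (mutate frozen (Inl k) R) i"
  using assms by (simp add: green_def mutate_apply frozen_def del: of_nat_add of_nat_mult)

lemma green_unless_mutated:
  assumes "green R i" "green_from n R sq" "i \<notin> set sq" shows "green (mutate_seq R sq) i"
  using assms by (induction sq arbitrary: R) (auto intro: green_mutate)

text \<open>Vertex \<open>v\<close> is where the simple roots \<open>v - 1\<close> and
  \<open>v\<close> meet, so inner vertices start at 1. On \<open>0\<close>, ..., \<open>n\<close>
  the form \<open>omega\<close> reads only inner signs, as an end is never the middle of three
  vertices.\<close>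

definition orientation :: "nat quiver \<Rightarrow> int \<Rightarrow> bool" where
  "orientation Q v \<longleftrightarrow> Q (nat v - 1) (nat v) = 1"

lemma represents_frame:
  assumes "is_An_quiver n Q"
  shows "represents n (orientation Q) (\<lambda>i. (int i, int i + 1)) (frame n Q)"
proof -
  have "Q i j = nat (omega (orientation Q) (int i, int i + 1) (int j, int j + 1))" if ij: "i < n" "j < n" for i j
  proof -
    consider "j = Suc i" | "i = Suc j" | "\<not> (j = i + 1 \<or> i = j + 1)" by auto
    then show ?thesis
    proof cases
      case 1
      have "orientation Q (1 + int i) \<longleftrightarrow> Q i (Suc i) = 1" by (simp add: orientation_def nat_add_distrib)
      then show ?thesis using 1 assms ij unfolding omega_start_tree is_An_quiver_def by auto
    next
      case 2
      have "orientation Q (1 + int j) \<longleftrightarrow> Q j (Suc j) = 1" by (simp add: orientation_def nat_add_distrib)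
      then show ?thesis using 2 assms ij unfolding omega_start_tree is_An_quiver_def by auto
    next
      case 3
      then have "Q i j = 0" using assms by (simp add: is_An_quiver_def)
      moreover have "int i \<noteq> int j - 1" "int i \<noteq> int j + 1" using 3 by auto
      ultimately show ?thesis by (simp add: omega_start_tree)
    qed
  qed
  then show ?thesis by (auto simp: represents_def frame_def cvec_def)
qed

lemma image_start_tree: "(\<lambda>i. (int i, int i + 1)) ` {..<n} = start_tree n"
  by (simp add: start_tree_def)

theorem theorem4p1:
  fixes n :: nat and Q :: "nat quiver"
  assumes "n \<ge> 1" and "is_An_quiver n Q"
  shows "{l. \<exists>s. maximal_green_sequence n Q s \<and> length s = l} = {n .. n * (n + 1) div 2}"
proof -
  let ?s = "orientation Q" and ?e = "\<lambda>i. (int i, int i + 1)"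
  let ?F = "start_tree n"
  have lab: "labelled n ?s ?e"
    unfolding labelled_def image_start_tree using cambrian_start_tree verts_start_tree by (auto simp: inj_on_def)
  have chain_lengths: "{l. \<exists>s. maximal_green_sequence n Q s \<and> length s = l} = chain_lengths ?s ?F"
    using green_chain_lengths[OF represents_frame[OF assms(2)] lab]
    unfolding image_start_tree maximal_green_sequence_def green_sequence_def by blast
  have lower: "n \<le> length sq" if "maximal_green_sequence n Q sq" for sq
  proof -
    have "i \<in> set sq" if "i < n" for i
    proof (rule ccontr)
      assume "i \<notin> set sq"
      moreover have "green (frame n Q) i" by (simp add: green_def frame_def)
      ultimately have "green (mutate_seq (frame n Q) sq) i"
        using \<open>maximal_green_sequence n Q sq\<close> green_unless_mutated
        by (auto simp: maximal_green_sequence_def green_sequence_def)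
      then show False using \<open>maximal_green_sequence n Q sq\<close> that by (auto simp: maximal_green_sequence_def)
    qed
    then have "{..<n} \<subseteq> set sq" by auto
    then have "n \<le> card (set sq)" using card_mono[of "set sq" "{..<n}"] by simp
    then show ?thesis using card_length[of sq] by linarith
  qed
  show ?thesis
  proof (intro set_eqI iffI)
    fix l assume l: "l \<in> {l. \<exists>s. maximal_green_sequence n Q s \<and> length s = l}"
    then have "n \<le> l" using lower by blast
    moreover have "l \<le> n * (n + 1) div 2"
      using chain_lengths_upper[OF cambrian_start_tree verts_start_tree, of l ?s n] l unfolding chain_lengths .
    ultimately show "l \<in> {n .. n * (n + 1) div 2}" by simp
  next
    fix l assume "l \<in> {n .. n * (n + 1) div 2}"
    then have "n \<le> l" "l \<le> n * (n + 1) div 2" by simp_all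
    then show "l \<in> {l. \<exists>s. maximal_green_sequence n Q s \<and> length s = l}"
      unfolding chain_lengths using chain_lengths_interval[OF cambrian_start_tree verts_start_tree, of ?s n] start_tree_lens_min[of n ?s] start_tree_lens_max[of n ?s]
      by blast
  qed
qed

end
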